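(* Let $1\le p<2$ and let $\{X_n,n\ge1\}$ be a sequence of random variables satisfying the variance condition (V) for some constant $C$. Let $L$ be a slowly varying function defined on $[0,\infty)$ satisfying the standing assumptions (S); when $p=1$, assume further that $L(x)\ge 1$ for all $x$ and $L$ is increasing on $[0,\infty)$. If $$\sup_{n\ge1}\mathbb{E}\left(|X_n|^pL^p(|X_n|)\log(|X_n|)\log^2(\log(|X_n|))\right)<\infty,$$ then for every $\alpha\ge 1/p$, $$\sum_{n=1}^{\infty} n^{\alpha p-2}\,\mathbb{P}\left(\max_{1\le j\le n}\left|\sum_{i=1}^{j}(X_i-\mathbb{E}(X_i))\right|>\varepsilon n^{\alpha}\tilde{L}(n^{\alpha})\right)<\infty\quad\text{for all }\varepsilon>0,$$ where $\tilde L$ is the de Bruijn conjugate of $L$.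
   Context: Throughout, $\log(x)$ denotes the natural logarithm of $\max\{x,e\}$, $x\ge0$. A function $R$ is regularly varying with index $\rho\in\mathbb{R}$ if it is positive and measurable on $[A,\infty)$ for some $A>0$ and $\lim_{x\to\infty}R(\lambda x)/R(x)=\lambda^\rho$ for each $\lambda>0$; slowly varying means index $0$. For a slowly varying $L$, its de Bruijn conjugate $\tilde L$ is a slowly varying function (unique up to asymptotic equivalence) with $\lim_{x\to\infty}L(x)\tilde L(xL(x))=1$ and $\lim_{x\to\infty}\tilde L(x)L(x\tilde L(x))=1$. Standing assumptions (S): $L$ and $\tilde L$ are both continuous on $[0,\infty)$ and differentiable on $[A,\infty)$ for some $A>0$, and $\lim_{x\to\infty}xL'(x)/L(x)=0$. Variance condition (V): there is a constant $C$ such that for all integers $k\ge0$, $\ell\ge1$ and all nondecreasing functions $f_i:\mathbb{R}\to\mathbb{R}$, $i\ge1$, $\operatorname{Var}\left(\sum_{i=k+1}^{k+\ell}f_i(X_i)\right)\le C\sum_{i=k+1}^{k+\ell}\operatorname{Var}(f_i(X_i))$, provided the variances exist. (The $X_n$ are assumed integrable.) *)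

theory Defs
  imports "HOL-Probability.Probability"
begin

text \<open>The paper's log: natural log of max x e.\<close>
definition logm :: "real \<Rightarrow> real" where
  "logm x = ln (max x (exp 1))"

definition regularly_varying :: "(real \<Rightarrow> real) \<Rightarrow> real \<Rightarrow> bool" where
  "regularly_varying R \<rho> \<longleftrightarrow>
     (\<exists>A>0. (\<forall>x\<ge>A. R x > 0) \<and> R \<in> borel_measurable (restrict_space borel {A..}) \<and>
       (\<forall>c>0. ((\<lambda>x. R (c * x) / R x) \<longlongrightarrow> c powr \<rho>) at_top))"

definition slowly_varying :: "(real \<Rightarrow> real) \<Rightarrow> bool" where
  "slowly_varying L \<longleftrightarrow> regularly_varying L 0"

definition de_bruijn_conjugate :: "(real \<Rightarrow> real) \<Rightarrow> (real \<Rightarrow> real) \<Rightarrow> bool" where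
  "de_bruijn_conjugate L Lt \<longleftrightarrow> slowly_varying Lt \<and>
     ((\<lambda>x. L x * Lt (x * L x)) \<longlongrightarrow> 1) at_top \<and>
     ((\<lambda>x. Lt x * L (x * Lt x)) \<longlongrightarrow> 1) at_top"

definition standing_S :: "(real \<Rightarrow> real) \<Rightarrow> (real \<Rightarrow> real) \<Rightarrow> bool" where
  "standing_S L Lt \<longleftrightarrow> continuous_on {0..} L \<and> continuous_on {0..} Lt \<and>
     (\<exists>A>0. L differentiable_on {A..} \<and> Lt differentiable_on {A..}) \<and>
     ((\<lambda>x. x * deriv L x / L x) \<longlongrightarrow> 0) at_top"

definition variance_cond :: "'a measure \<Rightarrow> (nat \<Rightarrow> 'a \<Rightarrow> real) \<Rightarrow> real \<Rightarrow> bool" where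
  "variance_cond M X C \<longleftrightarrow>
     (\<forall>(k::nat) (l::nat) (f::nat \<Rightarrow> real \<Rightarrow> real). l \<ge> 1 \<longrightarrow> (\<forall>i\<ge>1. mono (f i)) \<longrightarrow>
        (\<forall>i\<in>{k+1..k+l}. integrable M (\<lambda>\<omega>. (f i (X i \<omega>))\<^sup>2)) \<longrightarrow>
        prob_space.variance M (\<lambda>\<omega>. \<Sum>i\<in>{k+1..k+l}. f i (X i \<omega>))
          \<le> C * (\<Sum>i\<in>{k+1..k+l}. prob_space.variance M (\<lambda>\<omega>. f i (X i \<omega>))))"

end

theory Submission
  imports Defs "HOL-Library.Discrete_Functions" "HOL-Real_Asymp.Real_Asymp"
begin

text \<open>
  Write \<open>b\<^sub>k\<close> for the normalising constant at \<open>n = 2\<^sup>k\<close>. The moment condition bounds the tails, the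
  truncated second moments and the truncated means of all \<open>X\<^sub>i\<close> at level \<open>b\<^sub>k\<close> by
  \<open>2\<close> to the power \<open>- k \<alpha> p\<close> times a sequence of order \<open>1 / (k ln\<^sup>2 k)\<close>; this is where the factor
  \<open>log (log log)\<^sup>2\<close> enters, and its summability replaces stochastic domination.

  Without independence a single truncation level would cost the Rademacher--Menshov logarithms in a
  maximal inequality. Following Rio, a partial sum is instead split along the dyadic
  expansion of its length, and on blocks of length \<open>2\<^sup>k\<close> the variables are truncated at
  \<open>b\<^sub>k\<close>. The variance condition with Chebyshev's inequality controls every block, with
  thresholds decaying geometrically in \<open>m - k\<close> below the top level \<open>m\<close>. The change of truncation level
  between neighbouring scales is a nonnegative nondecreasing function of the variable once
  \<open>X\<^sub>i\<close> has been replaced by its positive and negative parts, so incomplete blocks are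
  dominated by complete ones.
\<close>

subsection \<open>Normalized slowly varying functions\<close>

text \<open>The Zygmund class: the logarithmic derivative is o(1/x). Unlike plain slow variation
  this makes \<open>x powr s * F x\<close> increasing and \<open>x powr (-s) * F x\<close>
  decreasing far out, for every \<open>s > 0\<close>, and not only up to asymptotic
  equivalence.\<close>

definition normalized_slowly_varying :: "(real \<Rightarrow> real) \<Rightarrow> bool" where
  "normalized_slowly_varying F \<longleftrightarrow>
     (\<forall>\<^sub>F x in at_top. F x > 0 \<and> F differentiable (at x)) \<and>
     ((\<lambda>x. x * deriv F x / F x) \<longlongrightarrow> 0) at_top"

lemma normalized_slowly_varyingI:
  assumes "\<forall>\<^sub>F x in at_top. F x > 0 \<and> (F has_real_derivative F' x) (at x)"
    and "((\<lambda>x. x * F' x / F x) \<longlongrightarrow> 0) at_top"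
  shows "normalized_slowly_varying F"
  unfolding normalized_slowly_varying_def
proof (intro conjI)
  show "\<forall>\<^sub>F x in at_top. F x > 0 \<and> F differentiable (at x)"
    using assms(1) by eventually_elim (auto simp: real_differentiable_def)
  have "\<forall>\<^sub>F x in at_top. x * F' x / F x = x * deriv F x / F x"
    using assms(1) by eventually_elim (auto dest: DERIV_imp_deriv)
  from tendsto_cong[OF this] assms(2) show "((\<lambda>x. x * deriv F x / F x) \<longlongrightarrow> 0) at_top"
    by blast
qed

lemma normalized_slowly_varyingD:
  assumes "normalized_slowly_varying F"
  shows "\<forall>\<^sub>F x in at_top. F x > 0 \<and> (F has_real_derivative deriv F x) (at x)"
  using assms unfolding normalized_slowly_varying_def
  by (auto elim!: eventually_mono simp: DERIV_deriv_iff_real_differentiable)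

text \<open>The quantity \<open>x * deriv F x / F x\<close> is additive under products. Under powers
  it is multiplied by the exponent, which settles the next lemma in the same way.\<close>

lemma normalized_slowly_varying_mult:
  assumes "normalized_slowly_varying F" "normalized_slowly_varying G"
  shows "normalized_slowly_varying (\<lambda>x. F x * G x)"
proof (rule normalized_slowly_varyingI[where F' = "\<lambda>x. deriv F x * G x + deriv G x * F x"])
  note F = normalized_slowly_varyingD[OF assms(1)] and G = normalized_slowly_varyingD[OF assms(2)]
  show "\<forall>\<^sub>F x in at_top. F x * G x > 0 \<and>
      ((\<lambda>x. F x * G x) has_real_derivative deriv F x * G x + deriv G x * F x) (at x)"
    using F G by eventually_elim (auto intro: DERIV_mult)
  have "((\<lambda>x. x * deriv F x / F x + x * deriv G x / G x) \<longlongrightarrow> 0 + 0) at_top"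
    using assms by (intro tendsto_add) (auto simp: normalized_slowly_varying_def)
  moreover have "\<forall>\<^sub>F x in at_top. x * deriv F x / F x + x * deriv G x / G x =
      x * (deriv F x * G x + deriv G x * F x) / (F x * G x)"
    using F G by eventually_elim (auto simp: field_simps)
  ultimately show "((\<lambda>x. x * (deriv F x * G x + deriv G x * F x) / (F x * G x)) \<longlongrightarrow> 0) at_top"
    by (auto elim: Lim_transform_eventually)
qed

lemma normalized_slowly_varying_powr:
  assumes "normalized_slowly_varying F"
  shows "normalized_slowly_varying (\<lambda>x. F x powr a)"
proof (rule normalized_slowly_varyingI[where F' = "\<lambda>x. a * F x powr (a - 1) * deriv F x"])
  note F = normalized_slowly_varyingD[OF assms(1)]
  show "\<forall>\<^sub>F x in at_top. F x powr a > 0 \<and>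
      ((\<lambda>x. F x powr a) has_real_derivative a * F x powr (a - 1) * deriv F x) (at x)"
    using F by eventually_elim (auto intro!: DERIV_fun_powr derivative_eq_intros simp: powr_diff)
  have "((\<lambda>x. a * (x * deriv F x / F x)) \<longlongrightarrow> a * 0) at_top"
    using assms by (intro tendsto_mult) (auto simp: normalized_slowly_varying_def)
  moreover have "\<forall>\<^sub>F x in at_top. a * (x * deriv F x / F x) =
      x * (a * F x powr (a - 1) * deriv F x) / (F x powr a)"
    using F by eventually_elim (auto simp: field_simps powr_diff)
  ultimately show "((\<lambda>x. x * (a * F x powr (a - 1) * deriv F x) / (F x powr a)) \<longlongrightarrow> 0) at_top"
    by (auto elim: Lim_transform_eventually)
qed

text \<open>The derivative of \<open>x powr s * F x\<close> is \<open>x powr (s - 1) * F x\<close>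
  times \<open>s + x * deriv F x / F x\<close>, and the last factor tends to
  \<open>s > 0\<close>.\<close>

lemma normalized_slowly_varying_mono:
  assumes "normalized_slowly_varying F" "s > 0"
  shows "\<exists>A>0. mono_on {A..} (\<lambda>x. x powr s * F x)"
proof -
  have "\<forall>\<^sub>F x in at_top. x * deriv F x / F x > -s"
    using assms by (intro order_tendstoD[where y=0]) (auto simp: normalized_slowly_varying_def)
  with normalized_slowly_varyingD[OF assms(1)] eventually_gt_at_top[of 0]
  have "\<forall>\<^sub>F x in at_top. x > 0 \<and> (\<exists>D\<ge>0. ((\<lambda>x. x powr s * F x) has_real_derivative D) (at x))"
  proof eventually_elim
    case (elim x)
    have "((\<lambda>x. x powr s * F x) has_real_derivative
        s * x powr (s - 1) * F x + deriv F x * x powr s) (at x)"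
      using elim by (auto intro!: derivative_eq_intros simp: powr_diff)
    moreover have "s * x powr (s - 1) * F x + deriv F x * x powr s =
        x powr (s - 1) * F x * (s + x * deriv F x / F x)"
      using elim by (simp add: powr_diff field_simps)
    moreover have "\<dots> \<ge> 0" using elim by auto
    ultimately show ?case using elim by metis
  qed
  then obtain A where A: "\<And>x. x \<ge> A \<Longrightarrow> x > 0 \<and> (\<exists>D\<ge>0. ((\<lambda>x. x powr s * F x) has_real_derivative D) (at x))"
    unfolding eventually_at_top_linorder by blast
  have "mono_on {A..} (\<lambda>x. x powr s * F x)"
  proof (rule mono_onI)
    fix x y assume "x \<in> {A..}" "y \<in> {A..}" "x \<le> y"
    then have "\<exists>D. ((\<lambda>x. x powr s * F x) has_real_derivative D) (at z) \<and> D \<ge> 0" if "x \<le> z" for z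
      using A[of z] that by auto
    with \<open>x \<le> y\<close> show "x powr s * F x \<le> y powr s * F y"
      by (intro DERIV_nonneg_imp_nondecreasing[of x y "\<lambda>x. x powr s * F x"])
  qed
  with A show ?thesis by blast
qed

text \<open>Apply the previous lemma to the reciprocal \<open>F x powr (-1)\<close> and
  invert.\<close>

lemma normalized_slowly_varying_antimono:
  assumes "normalized_slowly_varying F" "s > 0"
  shows "\<exists>A>0. antimono_on {A..} (\<lambda>x. x powr (-s) * F x)"
proof -
  obtain A where A: "A > 0" "mono_on {A..} (\<lambda>x. x powr s * F x powr (-1))"
    using normalized_slowly_varying_mono[OF normalized_slowly_varying_powr[OF assms(1), of "-1"] assms(2)]
    by blast
  obtain B where B: "\<And>x. x \<ge> B \<Longrightarrow> F x > 0"
    using normalized_slowly_varyingD[OF assms(1)] unfolding eventually_at_top_linorder by blast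
  have "antimono_on {max A B..} (\<lambda>x. x powr (-s) * F x)"
  proof (rule monotone_onI)
    fix x y assume xy: "x \<in> {max A B..}" "y \<in> {max A B..}" "x \<le> y"
    then have "F x > 0" "F y > 0" "x > 0" using A B by auto
    moreover have "x powr s * F x powr (-1) \<le> y powr s * F y powr (-1)"
      using A(2) xy by (auto intro: mono_onD)
    ultimately have "x powr s / F x \<le> y powr s / F y" by (simp add: powr_minus divide_inverse)
    with xy A \<open>F x > 0\<close> \<open>F y > 0\<close> show "y powr (-s) * F y \<le> x powr (-s) * F x"
      by (simp add: powr_minus field_simps abs_of_pos)
  qed
  with A show ?thesis by (metis less_max_iff_disj)
qed

lemma eventually_logm_eq_ln: "\<forall>\<^sub>F x in at_top. logm x = ln x \<and> logm (ln x) = ln (ln x)"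
proof -
  have "filterlim ln at_top (at_top :: real filter)" by (rule ln_at_top)
  then have "\<forall>\<^sub>F x::real in at_top. ln x \<ge> exp 1" by (simp add: filterlim_at_top)
  with eventually_ge_at_top[of "exp (1::real)"] show ?thesis
    by eventually_elim (auto simp: logm_def max_def)
qed

text \<open>With this the moment weight is \<open>x powr p\<close> times a single normalised slowly
  varying function.\<close>

lemma normalized_slowly_varying_logs:
  "normalized_slowly_varying (\<lambda>x. ln x * (ln (ln x))\<^sup>2)"
proof (rule normalized_slowly_varyingI[where
      F' = "\<lambda>x. (ln (ln x))\<^sup>2 / x + 2 * ln (ln x) / x"])
  show "\<forall>\<^sub>F x in at_top. 0 < ln x * (ln (ln x))\<^sup>2 \<and> ((\<lambda>x. ln x * (ln (ln x))\<^sup>2)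
      has_real_derivative (ln (ln x))\<^sup>2 / x + 2 * ln (ln x) / x) (at x)"
    using eventually_gt_at_top[of "exp (1::real)"]
  proof eventually_elim
    case (elim x)
    have "x > 1" using elim exp_ge_add_one_self[of 1] by linarith
    then have "ln x > 1" using elim ln_less_cancel_iff[of "exp 1" x] by auto
    with \<open>x > 1\<close> show ?case
      by (auto intro!: derivative_eq_intros simp: field_simps power2_eq_square zero_less_mult_iff)
  qed
  show "((\<lambda>x::real. x * ((ln (ln x))\<^sup>2 / x + 2 * ln (ln x) / x) / (ln x * (ln (ln x))\<^sup>2)) \<longlongrightarrow> 0) at_top"
    by real_asymp
qed

subsection \<open>Growth of the de Bruijn conjugate\<close>

text \<open>Cauchy condensation turns the series into that of \<open>1 / real n ^ 2\<close>, up to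
  the factor \<open>1 / (ln 2)\<^sup>2\<close>.\<close>

lemma summable_inverse_n_ln_squared: "summable (\<lambda>n::nat. 1 / (real n * (ln (real n))\<^sup>2))"
proof -
  \<comment> \<open>The \<open>max 2\<close> repairs the term at 1: there \<open>ln 1 = 0\<close>,
    and division by zero would give the value 0, which breaks the monotonicity that condensation
    asks for.\<close>
  define f where "f n = 1 / (real n * (ln (max 2 (real n)))\<^sup>2)" for n
  have "summable f \<longleftrightarrow> summable (\<lambda>n. 2 ^ n * f (2 ^ n))"
  proof (rule condensation_test)
    fix m :: nat assume "0 < m"
    then show "f (Suc m) \<le> f m"
      unfolding f_def by (intro divide_left_mono mult_mono power_mono mult_pos_pos) auto
  qed (simp add: f_def)
  moreover have "summable (\<lambda>n. 2 ^ n * f (2 ^ n))"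
  proof (rule summable_comparison_test_ev)
    show "\<forall>\<^sub>F n in sequentially. norm (2 ^ n * f (2 ^ n)) \<le> 1 / (ln 2)\<^sup>2 * inverse (real n ^ 2)"
      using eventually_gt_at_top[of 0]
    proof eventually_elim
      case (elim n)
      have "(2::real) ^ 1 \<le> 2 ^ n" using elim by (intro power_increasing) auto
      then have "max 2 (2 ^ n) = (2::real) ^ n" by simp
      then show ?case by (simp add: f_def ln_realpow power_mult_distrib field_simps)
    qed
    show "summable (\<lambda>n. 1 / (ln 2)\<^sup>2 * inverse (real n ^ 2))"
      by (intro summable_mult inverse_power_summable) simp
  qed
  ultimately have "summable f" by simp
  moreover have "\<forall>\<^sub>F n in sequentially. f n = 1 / (real n * (ln (real n))\<^sup>2)"
    using eventually_ge_at_top[of 2] by eventually_elim (simp add: f_def max_def)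
  from summable_cong[OF this] have "summable f \<longleftrightarrow> summable (\<lambda>n. 1 / (real n * (ln (real n))\<^sup>2))" .
  ultimately show ?thesis by simp
qed

lemma inverse_n_ln_squared_scale_bigo:
  fixes \<alpha> :: real
  assumes "c > 0"
  shows "(\<lambda>k::nat. 1 / (c * real k * (ln (c * real k))\<^sup>2)) \<in> O(\<lambda>k. 1 / (real k * (ln (real k))\<^sup>2))"
  using assms by real_asymp

lemma standing_S_normalized_slowly_varying:
  assumes "slowly_varying L" "standing_S L Lt"
  shows "normalized_slowly_varying L"
proof -
  obtain A where A: "L differentiable_on {A..}" using assms(2) by (auto simp: standing_S_def)
  have "L differentiable (at x)" if "x > A" for x
  proof -
    have "L differentiable_on {A<..}" by (rule differentiable_on_subset[OF A]) auto
    then show ?thesis using that by (auto simp: differentiable_on_eq_differentiable_at)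
  qed
  moreover obtain B where "\<And>x. x \<ge> B \<Longrightarrow> L x > 0"
    using assms(1) by (auto simp: slowly_varying_def regularly_varying_def)
  ultimately have "\<forall>\<^sub>F x in at_top. L x > 0 \<and> L differentiable (at x)"
    using eventually_ge_at_top[of "max B (A + 1)"] by (auto elim: eventually_mono)
  with assms(2) show ?thesis by (simp add: normalized_slowly_varying_def standing_S_def)
qed

lemma slowly_varying_eventually_pos:
  assumes "slowly_varying L"
  shows "\<forall>\<^sub>F x in at_top. L x > 0"
  using assms by (auto simp: slowly_varying_def regularly_varying_def eventually_at_top_linorder)

lemma slowly_varying_tendsto:
  assumes "slowly_varying L" "c > 0"
  shows "((\<lambda>x. L (c * x) / L x) \<longlongrightarrow> 1) at_top"
  using assms by (auto simp: slowly_varying_def regularly_varying_def)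

text \<open>If \<open>x * Lt x\<close> fell below \<open>Z\<close> for arbitrarily large
  \<open>x\<close>, continuity would bound \<open>L\<close> on \<open>{0..Z}\<close> by some
  \<open>B\<close>, and \<open>Lt x * L (x * Lt x)\<close> would be at most
  \<open>\<bar>Z\<bar> * B / x\<close> there. This contradicts the limit 1.\<close>

lemma de_bruijn_conjugate_at_top:
  assumes "standing_S L Lt" "de_bruijn_conjugate L Lt"
  shows "filterlim (\<lambda>x. x * Lt x) at_top at_top"
  unfolding filterlim_at_top
proof
  fix Z :: real
  have "continuous_on {0..Z} L"
    using assms(1) by (auto simp: standing_S_def intro: continuous_on_subset)
  then have "bounded (L ` {0..Z})" by (intro compact_imp_bounded compact_continuous_image) auto
  then obtain B where B: "B > 0" "\<And>u. u \<in> {0..Z} \<Longrightarrow> \<bar>L u\<bar> \<le> B"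
    unfolding bounded_pos by (auto simp: image_iff)
  have "((\<lambda>x. Lt x * L (x * Lt x)) \<longlongrightarrow> 1) at_top"
    using assms(2) by (simp add: de_bruijn_conjugate_def)
  then have lim: "\<forall>\<^sub>F x in at_top. Lt x * L (x * Lt x) > 1 / 2" by (rule order_tendstoD) simp
  have "\<forall>\<^sub>F x in at_top. Lt x > 0"
    using assms(2) by (auto simp: de_bruijn_conjugate_def intro: slowly_varying_eventually_pos)
  with lim eventually_gt_at_top[of "2 * (\<bar>Z\<bar> * B)"] eventually_gt_at_top[of 0]
  show "\<forall>\<^sub>F x in at_top. Z \<le> x * Lt x"
  proof eventually_elim
    case (elim x)
    show ?case
    proof (rule ccontr)
      assume "\<not> Z \<le> x * Lt x"
      then have *: "x * Lt x \<in> {0..Z}" using elim by auto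
      then have "x * (Lt x * L (x * Lt x)) \<le> x * (Lt x * B)" using B(2)[OF *] elim by (intro mult_left_mono) auto
      also have "\<dots> = (x * Lt x) * B" by simp
      also have "\<dots> \<le> \<bar>Z\<bar> * B" using * B(1) by (intro mult_right_mono) auto
      finally have "x * (1 / 2) < \<bar>Z\<bar> * B"
        using mult_strict_left_mono[of "1 / 2" "Lt x * L (x * Lt x)" x] elim by linarith
      then show False using elim by simp
    qed
  qed
qed

text \<open>In this form \<open>y * L y\<close> is an asymptotic inverse of \<open>x * Lt x\<close>,
  and the size of \<open>x * Lt x\<close> can be read off from it.\<close>

lemma de_bruijn_inverse_tendsto:
  assumes "de_bruijn_conjugate L Lt"
  shows "((\<lambda>x. x * Lt x * L (x * Lt x) / x) \<longlongrightarrow> 1) at_top"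
proof -
  have "((\<lambda>x. Lt x * L (x * Lt x)) \<longlongrightarrow> 1) at_top"
    using assms by (simp add: de_bruijn_conjugate_def)
  then show ?thesis
    by (rule Lim_transform_eventually)
       (use eventually_gt_at_top[of 0] in \<open>eventually_elim, auto\<close>)
qed

text \<open>(S) bounds the logarithmic derivative of \<open>L\<close> but not that of
  \<open>Lt\<close>, so the comparison is pulled back through \<open>y * L y\<close>, which is
  increasing far out: if \<open>x * Lt x\<close> were too small against \<open>z * Lt z\<close>,
  then \<open>x\<close> would be too small against \<open>z\<close>. The bound is uniform in
  \<open>z\<close>, which the pointwise limits in the definition of slow variation do not give at
  once.\<close>

lemma de_bruijn_comparable:
  assumes L: "slowly_varying L" and S: "standing_S L Lt" and conj: "de_bruijn_conjugate L Lt" and "q \<ge> 1"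
  shows "\<exists>c>0. \<forall>\<^sub>F x in at_top. \<forall>z. x \<le> z \<and> z \<le> q * x \<longrightarrow> c * (z * Lt z) \<le> x * Lt x"
proof -
  \<comment> \<open>With this \<open>c\<close> the chain below ends in
    \<open>3 / 4 * x < 9 / 16 * x\<close>: two factors 3/2 from the limits, times
    \<open>c * q = 1 / 4\<close>.\<close>
  define c where "c = 1 / (4 * q)"
  have c: "c > 0" using \<open>q \<ge> 1\<close> by (simp add: c_def)
  obtain A where A: "A > 0" "mono_on {A..} (\<lambda>x. x * L x)"
  proof -
    obtain A where "A > 0" "mono_on {A..} (\<lambda>x. x powr 1 * L x)"
      using normalized_slowly_varying_mono[OF standing_S_normalized_slowly_varying[OF L S], of 1] by auto
    then show ?thesis by (intro that[of A]) (auto simp: monotone_on_def)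
  qed
  note y = de_bruijn_conjugate_at_top[OF S conj]
  have "((\<lambda>x. L (c * (x * Lt x)) / L (x * Lt x)) \<longlongrightarrow> 1) at_top"
    by (rule filterlim_compose[OF slowly_varying_tendsto[OF L c] y])
  then have "\<forall>\<^sub>F x in at_top. L (c * (x * Lt x)) / L (x * Lt x) < 3 / 2"
    by (rule order_tendstoD) simp
  moreover have "\<forall>\<^sub>F x in at_top. L (x * Lt x) > 0"
    by (rule eventually_compose_filterlim[OF slowly_varying_eventually_pos[OF L] y])
  moreover have "\<forall>\<^sub>F x in at_top. x * Lt x * L (x * Lt x) / x < 3 / 2"
    "\<forall>\<^sub>F x in at_top. x * Lt x * L (x * Lt x) / x > 3 / 4"
    by (rule order_tendstoD[OF de_bruijn_inverse_tendsto[OF conj]], simp)+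
  moreover have "\<forall>\<^sub>F x in at_top. x * Lt x \<ge> A"
    using y unfolding filterlim_at_top by blast
  ultimately have "\<forall>\<^sub>F x in at_top. x > 0 \<and> x * Lt x \<ge> A \<and> L (x * Lt x) > 0 \<and>
      x * Lt x * L (x * Lt x) < 3 / 2 * x \<and> x * Lt x * L (x * Lt x) > 3 / 4 * x \<and>
      L (c * (x * Lt x)) < 3 / 2 * L (x * Lt x)"
    using eventually_gt_at_top[of 0] by eventually_elim (auto simp: field_simps)
  then obtain N where N: "\<And>x. x \<ge> N \<Longrightarrow> x > 0 \<and> x * Lt x \<ge> A \<and> L (x * Lt x) > 0 \<and>
      x * Lt x * L (x * Lt x) < 3 / 2 * x \<and> x * Lt x * L (x * Lt x) > 3 / 4 * x \<and>
      L (c * (x * Lt x)) < 3 / 2 * L (x * Lt x)"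
    unfolding eventually_at_top_linorder by blast
  have "c * (z * Lt z) \<le> x * Lt x" if x: "x \<ge> N" and z: "x \<le> z" "z \<le> q * x" for x z
  proof (rule ccontr)
    define u where "u = x * Lt x"
    define v where "v = z * Lt z"
    assume "\<not> c * (z * Lt z) \<le> x * Lt x"
    then have uv: "u \<le> c * v" by (simp add: u_def v_def)
    have Nx: "x > 0" "u \<ge> A" "u * L u > 3 / 4 * x" using N[OF x] by (auto simp: u_def)
    have Nz: "v \<ge> A" "v * L v < 3 / 2 * z" "L (c * v) < 3 / 2 * L v"
      using N[of z] x z by (auto simp: v_def)
    have "3 / 4 * x < u * L u" by (rule Nx)
    also have "\<dots> \<le> c * v * L (c * v)"
      using mono_onD[OF A(2), of u "c * v"] uv Nx(2) by simp
    also have "\<dots> \<le> c * v * (3 / 2 * L v)"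
      using Nz A(1) c by (intro mult_left_mono) auto
    also have "\<dots> = 3 / 2 * c * (v * L v)" by simp
    also have "\<dots> \<le> 3 / 2 * c * (3 / 2 * z)" using Nz c by (intro mult_left_mono) auto
    also have "\<dots> \<le> 3 / 2 * c * (3 / 2 * (q * x))" using z c by (intro mult_left_mono) auto
    also have "\<dots> = 9 / 16 * x" using \<open>q \<ge> 1\<close> by (simp add: c_def)
    finally show False using Nx(1) by simp
  qed
  with c show ?thesis by (auto simp: eventually_at_top_linorder)
qed

text \<open>Far out \<open>L u\<close> is at most a multiple of \<open>u\<close>. Since
  \<open>u * L u\<close> is close to \<open>x\<close> for \<open>u = x * Lt x\<close>, the size of
  \<open>u\<close> is at least of order the square root of \<open>x\<close>. The exponent 1/4
  absorbs the constants; later only the logarithm of this bound matters.\<close>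

lemma de_bruijn_powr_lower_bound:
  assumes L: "slowly_varying L" and S: "standing_S L Lt" and conj: "de_bruijn_conjugate L Lt"
  shows "\<forall>\<^sub>F x in at_top. x powr (1 / 4) \<le> x * Lt x"
proof -
  obtain A where A: "A > 0" "antimono_on {A..} (\<lambda>x. x powr (-1) * L x)"
    using normalized_slowly_varying_antimono[OF standing_S_normalized_slowly_varying[OF L S], of 1] by auto
  define B where "B = max 1 (L A / A)"
  have B: "B > 0" by (simp add: B_def)
  have LB: "L u \<le> B * u" if "u \<ge> A" for u
  proof -
    have "u powr (-1) * L u \<le> A powr (-1) * L A"
      using monotone_onD[OF A(2), of A u] that by auto
    then have "L u \<le> L A / A * u" using that A(1) by (simp add: powr_minus field_simps)
    also have "\<dots> \<le> B * u" using that A(1) by (intro mult_right_mono) (auto simp: B_def)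
    finally show ?thesis .
  qed
  have "\<forall>\<^sub>F x in at_top. x * Lt x \<ge> A"
    using de_bruijn_conjugate_at_top[OF S conj] unfolding filterlim_at_top by blast
  moreover have "\<forall>\<^sub>F x in at_top. x * Lt x * L (x * Lt x) / x > 1 / 2"
    by (rule order_tendstoD[OF de_bruijn_inverse_tendsto[OF conj]]) simp
  moreover have "\<forall>\<^sub>F x in at_top. (x powr (1 / 4))\<^sup>2 * B \<le> x / 2"
    unfolding B_def by real_asymp
  ultimately show ?thesis using eventually_gt_at_top[of 0]
  proof eventually_elim
    case (elim x)
    define u where "u = x * Lt x"
    have "1 / 2 < Lt x * L (x * Lt x)" using elim by simp
    then have "x * (1 / 2) < x * (Lt x * L (x * Lt x))" using elim by (intro mult_strict_left_mono) auto
    then have "(x powr (1 / 4))\<^sup>2 * B \<le> u * L u" using elim unfolding u_def mult.assoc by linarith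
    also have "\<dots> \<le> u * (B * u)" using elim A(1) LB[of u] by (intro mult_left_mono) (auto simp: u_def)
    finally have "(x powr (1 / 4))\<^sup>2 * B \<le> u\<^sup>2 * B" by (simp add: power2_eq_square mult_ac)
    then have "(x powr (1 / 4))\<^sup>2 \<le> u\<^sup>2" using B by simp
    moreover have "u \<ge> 0" using elim A(1) by (simp add: u_def)
    ultimately have "x powr (1 / 4) \<le> u" by (rule power2_le_imp_le)
    then show ?case by (simp add: u_def)
  qed
qed

subsection \<open>Dyadic chaining\<close>

lemma sum_greaterThanAtMost_split:
  fixes f :: "nat \<Rightarrow> real"
  assumes "a \<le> b" "b \<le> c"
  shows "sum f {a<..c} = sum f {a<..b} + sum f {b<..c}"
  using assms by (subst sum.union_disjoint[symmetric]) (auto intro!: sum.cong)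

text \<open>Here \<open>J k\<close> is \<open>j\<close> rounded down to a multiple of
  \<open>2 ^ k\<close>. In the induction step the whole remainder beyond \<open>J (Suc m)\<close> is
  lowered from level \<open>Suc m\<close> to level \<open>m\<close>, and then the block up to
  \<open>J m\<close> is split off. The start is an empty sum because \<open>J 0 = j\<close>.\<close>

lemma dyadic_chaining_identity:
  fixes x :: "nat \<Rightarrow> nat \<Rightarrow> real" and j :: nat
  defines "J \<equiv> \<lambda>k. j div 2 ^ k * 2 ^ k"
  shows "(\<Sum>i\<in>{J m<..j}. x m i) =
    (\<Sum>k<m. \<Sum>i\<in>{J (Suc k)<..J k}. x k i) +
    (\<Sum>k<m. \<Sum>i\<in>{J (Suc k)<..j}. x (Suc k) i - x k i)"
proof (induction m)
  case 0
  then show ?case by (simp add: J_def)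
next
  case (Suc m)
  have "j div 2 ^ Suc m * 2 = j div 2 ^ m div 2 * 2"
    by (simp only: power_Suc2 div_mult2_eq)
  then have "j div 2 ^ Suc m * 2 * 2 ^ m \<le> j div 2 ^ m * 2 ^ m"
    by (metis div_times_less_eq_dividend mult_le_mono1)
  then have le: "J (Suc m) \<le> J m" "J m \<le> j"
    by (simp_all add: J_def algebra_simps)
  have "(\<Sum>i\<in>{J (Suc m)<..j}. x (Suc m) i) =
      (\<Sum>i\<in>{J (Suc m)<..j}. x (Suc m) i - x m i) + (\<Sum>i\<in>{J (Suc m)<..j}. x m i)"
    by (simp add: sum_subtractf)
  also have "(\<Sum>i\<in>{J (Suc m)<..j}. x m i) =
      (\<Sum>i\<in>{J (Suc m)<..J m}. x m i) + (\<Sum>i\<in>{J m<..j}. x m i)"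
    using le by (rule sum_greaterThanAtMost_split)
  finally show ?case using Suc by simp
qed

text \<open>Nonnegativity replaces a maximal inequality inside the block: a part of the sum of
  \<open>u\<close> is at most the full sum, hence at most \<open>l\<close> plus the full sum of
  \<open>v\<close>, and the difference is never below minus the full sum of
  \<open>v\<close>.\<close>

lemma abs_partial_block_sum_le:
  fixes u v :: "nat \<Rightarrow> real"
  assumes u: "\<And>i. i > a \<Longrightarrow> u i \<ge> 0" and v: "\<And>i. i > a \<Longrightarrow> 0 \<le> v i \<and> v i \<le> D"
    and block: "\<bar>\<Sum>i\<in>{a<..a + N}. u i - v i\<bar> \<le> l" and "a \<le> j" "j \<le> a + N"
  shows "\<bar>\<Sum>i\<in>{a<..j}. u i - v i\<bar> \<le> l + real N * D"
proof -
  have sub: "{a<..j} \<subseteq> {a<..a+N}" using assms by auto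
  have v_le: "sum v {a<..a+N} \<le> real N * D"
    using v sum_bounded_above[of "{a<..a+N}" v D] by simp
  have v_j: "sum v {a<..j} \<le> sum v {a<..a+N}" "sum u {a<..j} \<le> sum u {a<..a+N}"
    using sub v u by (auto intro!: sum_mono2)
  have "0 \<le> sum u {a<..j}" "0 \<le> sum v {a<..j}" using u v by (auto intro!: sum_nonneg)
  with v_le v_j block show ?thesis unfolding sum_subtractf by linarith
qed

text \<open>The deterministic half of the chaining, valid off the exceptional events. In the
  application \<open>y k\<close> are the variables truncated at level \<open>k\<close> and
  \<open>e k\<close> their means; both increase with \<open>k\<close>, so an incomplete block costs
  only the extra term \<open>2 ^ Suc k * D k\<close>.\<close>

lemma dyadic_chaining_bound:
  fixes y e :: "nat \<Rightarrow> nat \<Rightarrow> real" and l D :: "nat \<Rightarrow> real"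
  assumes single: "\<And>k q. k < m \<Longrightarrow> q < 2 ^ (m - k) \<Longrightarrow>
      \<bar>\<Sum>i\<in>{q * 2 ^ k<..q * 2 ^ k + 2 ^ k}. y k i - e k i\<bar> \<le> l k"
    and incr: "\<And>k q. k < m \<Longrightarrow> q < 2 ^ (m - Suc k) \<Longrightarrow>
      \<bar>\<Sum>i\<in>{q * 2 ^ Suc k<..q * 2 ^ Suc k + 2 ^ Suc k}. (y (Suc k) i - y k i) - (e (Suc k) i - e k i)\<bar> \<le> l (Suc k)"
    and y: "\<And>k i. i > 0 \<Longrightarrow> y k i \<le> y (Suc k) i"
    and e: "\<And>k i. i > 0 \<Longrightarrow> e k i \<le> e (Suc k) i"
    and D: "\<And>k i. i > 0 \<Longrightarrow> e (Suc k) i - e k i \<le> D k"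
    and l: "\<And>k. l k \<ge> 0" and j: "j < 2 ^ m"
  shows "\<bar>\<Sum>i\<in>{0<..j}. y m i - e m i\<bar> \<le> (\<Sum>k<m. l k + l (Suc k) + 2 ^ Suc k * D k)"
proof -
  define J where "J k = j div 2 ^ k * 2 ^ k" for k
  have Jm: "J m = 0" using j by (simp add: J_def)
  have q: "j div 2 ^ k < 2 ^ (m - k)" if "k \<le> m" for k
    using j that by (simp add: less_mult_imp_div_less power_add[symmetric])
  have "\<bar>\<Sum>i\<in>{J (Suc k)<..J k}. y k i - e k i\<bar> \<le> l k" if "k < m" for k
  proof -
    \<comment> \<open>The binary digit of \<open>j\<close> at position \<open>k\<close> decides
      whether the block between \<open>J (Suc k)\<close> and \<open>J k\<close> is empty or is the
      full aligned block with the even number \<open>2 * r\<close>.\<close>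
    define r where "r = j div 2 ^ Suc k"
    have "j div 2 ^ k div 2 = r" by (simp only: r_def power_Suc2 div_mult2_eq)
    then have "j div 2 ^ k = 2 * r \<or> j div 2 ^ k = 2 * r + 1" by linarith
    then have "{J (Suc k)<..J k} = {} \<or> {J (Suc k)<..J k} = {(2 * r) * 2 ^ k<..(2 * r) * 2 ^ k + 2 ^ k}"
      by (auto simp: J_def r_def algebra_simps)
    moreover have "2 * r < 2 ^ (m - k)"
    proof -
      have "(2::nat) ^ (m - k) = 2 * 2 ^ (m - Suc k)" using that by (simp add: Suc_diff_Suc flip: power_Suc)
      with q[of "Suc k"] that show ?thesis unfolding r_def by linarith
    qed
    ultimately show ?thesis using single[of k "2 * r"] l[of k] that by auto
  qed
  moreover have "\<bar>\<Sum>i\<in>{J (Suc k)<..j}. (y (Suc k) i - e (Suc k) i) - (y k i - e k i)\<bar>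
      \<le> l (Suc k) + 2 ^ Suc k * D k" if "k < m" for k
  proof -
    have "j \<le> J (Suc k) + 2 ^ Suc k"
      using dividend_less_div_times[of "2 ^ Suc k" j] by (simp add: J_def)
    then have "\<bar>\<Sum>i\<in>{J (Suc k)<..j}. (y (Suc k) i - y k i) - (e (Suc k) i - e k i)\<bar>
        \<le> l (Suc k) + real (2 ^ Suc k) * D k"
      using y e D q[of "Suc k"] that incr[of k "j div 2 ^ Suc k"]
      by (intro abs_partial_block_sum_le) (auto simp: J_def)
    then show ?thesis by (simp add: algebra_simps)
  qed
  ultimately have "\<bar>(\<Sum>k<m. \<Sum>i\<in>{J (Suc k)<..J k}. y k i - e k i) +
    (\<Sum>k<m. \<Sum>i\<in>{J (Suc k)<..j}. (y (Suc k) i - e (Suc k) i) - (y k i - e k i))\<bar>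
    \<le> (\<Sum>k<m. l k) + (\<Sum>k<m. l (Suc k) + 2 ^ Suc k * D k)"
    by (intro order.trans[OF abs_triangle_ineq] add_mono order.trans[OF sum_abs[of _ "{..<m}"]] sum_mono) auto
  with dyadic_chaining_identity[of "\<lambda>k i. y k i - e k i" m j] Jm show ?thesis
    by (simp add: J_def sum.distrib add.assoc)
qed

section \<open>Maximal inequality for truncated variables\<close>

context prob_space
begin

lemma variance_le_second_moment:
  fixes Y :: "'a \<Rightarrow> real"
  assumes "integrable M Y" "integrable M (\<lambda>\<omega>. (Y \<omega>)\<^sup>2)"
  shows "variance Y \<le> expectation (\<lambda>\<omega>. (Y \<omega>)\<^sup>2)"
  using variance_eq[OF assms] by simp

text \<open>Chebyshev's inequality, with the variance condition in place of independence and the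
  same \<open>f\<close> applied to every variable. Boundedness of \<open>f\<close> supplies all the
  integrability.\<close>

lemma block_deviation_prob_le:
  fixes X :: "nat \<Rightarrow> 'a \<Rightarrow> real"
  assumes vc: "variance_cond M X C" and C: "C \<ge> 0"
    and X[measurable]: "\<And>n. X n \<in> borel_measurable M"
    and f: "mono f" and B: "\<And>x. \<bar>f x\<bar> \<le> B" and [measurable]: "f \<in> borel_measurable borel"
    and V: "\<And>i. i > 0 \<Longrightarrow> expectation (\<lambda>\<omega>. (f (X i \<omega>))\<^sup>2) \<le> V"
    and N: "N > 0" and l: "l > 0"
  shows "prob {\<omega>\<in>space M. \<bar>\<Sum>i\<in>{a<..a + N}. f (X i \<omega>) - expectation (\<lambda>\<omega>. f (X i \<omega>))\<bar> > l}
    \<le> C * real N * V / l\<^sup>2"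
proof -
  have sq_le: "x\<^sup>2 \<le> r\<^sup>2" if "\<bar>x\<bar> \<le> r" for x r :: real
    using that by (simp flip: abs_le_square_iff)
  have int: "integrable M (\<lambda>\<omega>. f (X i \<omega>))" for i
    by (rule integrable_const_bound[where B=B]) (use B in auto)
  have int2: "integrable M (\<lambda>\<omega>. (f (X i \<omega>))\<^sup>2)" for i
    by (rule integrable_const_bound[where B="B\<^sup>2"]) (use sq_le[OF B] in auto)
  define S where "S \<omega> = (\<Sum>i\<in>{a<..a + N}. f (X i \<omega>))" for \<omega>
  have S_meas[measurable]: "S \<in> borel_measurable M" unfolding S_def by measurable
  have "\<bar>S \<omega>\<bar> \<le> real N * B" for \<omega>
    unfolding S_def using sum_bounded_above[of "{a<..a+N}" "\<lambda>i. \<bar>f (X i \<omega>)\<bar>" B] B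
    by (intro order.trans[OF sum_abs]) auto
  then have S2: "integrable M (\<lambda>\<omega>. (S \<omega>)\<^sup>2)"
    by (intro integrable_const_bound[where B="(real N * B)\<^sup>2"]) (auto dest: sq_le)
  have eq: "{a + 1..a + N} = {a<..a + N}" by auto
  have "variance S \<le> C * (\<Sum>i\<in>{a<..a + N}. variance (\<lambda>\<omega>. f (X i \<omega>)))"
    using vc[unfolded variance_cond_def, rule_format, of N "\<lambda>_. f" a] N f int2
    unfolding S_def eq by auto
  also have "(\<Sum>i\<in>{a<..a + N}. variance (\<lambda>\<omega>. f (X i \<omega>))) \<le> real N * V"
    using sum_bounded_above[of "{a<..a+N}" "\<lambda>i. variance (\<lambda>\<omega>. f (X i \<omega>))" V]
      order.trans[OF variance_le_second_moment[OF int int2] V] by simp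
  finally have var: "variance S \<le> C * real N * V" using C by (simp add: mult_left_mono mult.assoc)
  have "expectation S = (\<Sum>i\<in>{a<..a + N}. expectation (\<lambda>\<omega>. f (X i \<omega>)))"
    unfolding S_def using int by (rule Bochner_Integration.integral_sum)
  then have "prob {\<omega>\<in>space M. \<bar>\<Sum>i\<in>{a<..a + N}. f (X i \<omega>) - expectation (\<lambda>\<omega>. f (X i \<omega>))\<bar> > l}
      \<le> prob {\<omega>\<in>space M. l \<le> \<bar>S \<omega> - expectation S\<bar>}"
    by (intro finite_measure_mono) (auto simp: S_def sum_subtractf)
  also have "\<dots> \<le> variance S / l\<^sup>2" using S2 l by (intro Chebyshev_inequality) auto
  also have "\<dots> \<le> C * real N * V / l\<^sup>2" using var by (simp add: divide_right_mono)
  finally show ?thesis .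
qed

lemma integrable_min:
  fixes X :: "'a \<Rightarrow> real"
  assumes "X \<in> borel_measurable M" "\<And>\<omega>. X \<omega> \<ge> 0" "b \<ge> 0"
  shows "integrable M (\<lambda>\<omega>. min (X \<omega>) b)" "integrable M (\<lambda>\<omega>. (min (X \<omega>) b)\<^sup>2)"
proof -
  have "\<bar>min (X \<omega>) b\<bar> \<le> b" for \<omega> using assms(2)[of \<omega>] assms(3) by auto
  moreover from this have "(min (X \<omega>) b)\<^sup>2 \<le> b\<^sup>2" for \<omega> using abs_le_square_iff[of "min (X \<omega>) b" b] assms(3) by auto
  ultimately show "integrable M (\<lambda>\<omega>. min (X \<omega>) b)" "integrable M (\<lambda>\<omega>. (min (X \<omega>) b)\<^sup>2)"
    using assms(1) integrable_const_bound[of "\<lambda>\<omega>. min (X \<omega>) b" b]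
      integrable_const_bound[of "\<lambda>\<omega>. (min (X \<omega>) b)\<^sup>2" "b\<^sup>2"] by simp_all
qed

text \<open>A union bound over the \<open>2 ^ (m - k)\<close> aligned blocks of level
  \<open>k\<close>, each failing with probability at most
  \<open>C * 2 ^ k * V k / (l k)\<^sup>2\<close>, costs
  \<open>C * 2 ^ m * V k / (l k)\<^sup>2\<close> per level. The factor 2 accounts for the truncated
  sums and for the increments between neighbouring levels.\<close>

lemma truncated_maximal_inequality:
  fixes X :: "nat \<Rightarrow> 'a \<Rightarrow> real" and b V D l :: "nat \<Rightarrow> real"
  assumes vc: "variance_cond M X C" and C: "C \<ge> 0"
    and X[measurable]: "\<And>n. X n \<in> borel_measurable M"
    and X0: "\<And>n \<omega>. X n \<omega> \<ge> 0" and X_int: "\<And>n. integrable M (X n)"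
    and b: "\<And>k. b k > 0" "incseq b"
    and V: "\<And>k i. i > 0 \<Longrightarrow> expectation (\<lambda>\<omega>. (min (X i \<omega>) (b k))\<^sup>2) \<le> V k"
    and D: "\<And>k i. i > 0 \<Longrightarrow> expectation (X i) - expectation (\<lambda>\<omega>. min (X i \<omega>) (b k)) \<le> D k"
    and l: "\<And>k. l k > 0"
  shows "prob {\<omega>\<in>space M. \<exists>j<2 ^ m. \<bar>\<Sum>i\<in>{0<..j}. min (X i \<omega>) (b m) - expectation (\<lambda>\<omega>. min (X i \<omega>) (b m))\<bar>
       > (\<Sum>k<m. l k + l (Suc k) + 2 ^ Suc k * D k)}
    \<le> 2 * C * 2 ^ m * (\<Sum>k\<le>m. V k / (l k)\<^sup>2)"
proof -
  define y where "y k i = (\<lambda>\<omega>. min (X i \<omega>) (b k))" for k i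
  define e where "e k i = expectation (y k i)" for k i
  have [measurable]: "y k i \<in> borel_measurable M" for k i unfolding y_def by measurable
  define A where "A k q = {\<omega>\<in>space M. \<bar>\<Sum>i\<in>{q * 2 ^ k<..q * 2 ^ k + 2 ^ k}. y k i \<omega> - e k i\<bar> > l k}" for k q :: nat
  define B where "B k q = {\<omega>\<in>space M. \<bar>\<Sum>i\<in>{q * 2 ^ Suc k<..q * 2 ^ Suc k + 2 ^ Suc k}.
      (y (Suc k) i \<omega> - y k i \<omega>) - (e (Suc k) i - e k i)\<bar> > l (Suc k)}" for k q :: nat
  have [measurable]: "A k q \<in> sets M" "B k q \<in> sets M" for k q unfolding A_def B_def by measurable
  have bS: "b k \<le> b (Suc k)" "0 \<le> b k" for k using b by (auto simp: incseq_Suc_iff less_imp_le)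
  have y_int: "integrable M (y k i)" "integrable M (\<lambda>\<omega>. (y k i \<omega>)\<^sup>2)" for k i
    unfolding y_def using integrable_min[OF X X0] bS by auto
  have y_le: "y k i \<omega> \<le> y (Suc k) i \<omega>" for k i \<omega> using bS(1)[of k] by (auto simp: y_def)
  have e_le: "e k i \<le> e (Suc k) i" for k i unfolding e_def using y_int y_le by (intro integral_mono)
  have eD: "e (Suc k) i - e k i \<le> D k" if "i > 0" for k i
  proof -
    have "e (Suc k) i \<le> expectation (X i)"
      unfolding e_def using y_int X_int by (intro integral_mono) (auto simp: y_def)
    with D[OF that, of k] show ?thesis by (simp add: e_def y_def)
  qed
  have V0: "V k \<ge> 0" for k using order.trans[OF Bochner_Integration.integral_nonneg V[of 1 k]] by simp
  have A: "prob (A k q) \<le> C * real (2 ^ k) * V k / (l k)\<^sup>2" for k q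
  proof -
    \<comment> \<open>The outer \<open>max 0\<close> changes nothing on nonnegative variables and
      makes the truncation bounded on the whole line, as the block bound requires.\<close>
    have "prob {\<omega>\<in>space M. \<bar>\<Sum>i\<in>{q * 2 ^ k<..q * 2 ^ k + 2 ^ k}. max 0 (min (X i \<omega>) (b k)) -
        expectation (\<lambda>\<omega>. max 0 (min (X i \<omega>) (b k)))\<bar> > l k} \<le> C * real (2 ^ k) * V k / (l k)\<^sup>2"
      using V[of _ k] X0 bS[of k] l
      by (intro block_deviation_prob_le[OF vc C X, where f = "\<lambda>x. max 0 (min x (b k))" and B = "b k"])
         (auto simp: mono_def max_def)
    then show ?thesis using X0 bS by (simp add: A_def e_def y_def max_def)
  qed
  have B: "prob (B k q) \<le> C * real (2 ^ Suc k) * V (Suc k) / (l (Suc k))\<^sup>2" for k q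
  proof -
    \<comment> \<open>The difference of two truncations as a clamp to the interval between the
      levels followed by a shift; in this form monotonicity and boundedness are visible.\<close>
    define f where "f x = max (b k) (min x (b (Suc k))) - b k" for x
    have f_eq: "f (X i \<omega>) = y (Suc k) i \<omega> - y k i \<omega>" for i \<omega>
      using bS[of k] by (auto simp: f_def y_def)
    have "expectation (\<lambda>\<omega>. (f (X i \<omega>))\<^sup>2) \<le> V (Suc k)" if "i > 0" for i
    proof -
      \<comment> \<open>The increment lies between 0 and the upper truncation, so
        \<open>V (Suc k)\<close> also bounds its second moment.\<close>
      have le: "(f (X i \<omega>))\<^sup>2 \<le> (y (Suc k) i \<omega>)\<^sup>2" for \<omega>
        using X0[of i \<omega>] bS[of k] bS[of "Suc k"] y_le[of k i \<omega>] unfolding f_eq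
        by (intro power_mono) (auto simp: y_def)
      have "expectation (\<lambda>\<omega>. (f (X i \<omega>))\<^sup>2) \<le> expectation (\<lambda>\<omega>. (y (Suc k) i \<omega>)\<^sup>2)"
        using y_int(2) le
        by (intro integral_mono Bochner_Integration.integrable_bound[OF y_int(2)[of "Suc k" i]]) (auto simp: f_def)
      with V[OF that, of "Suc k"] show ?thesis by (simp add: y_def)
    qed
    then have "prob {\<omega>\<in>space M. \<bar>\<Sum>i\<in>{q * 2 ^ Suc k<..q * 2 ^ Suc k + 2 ^ Suc k}. f (X i \<omega>) -
        expectation (\<lambda>\<omega>. f (X i \<omega>))\<bar> > l (Suc k)} \<le> C * real (2 ^ Suc k) * V (Suc k) / (l (Suc k))\<^sup>2"
      using bS[of k] bS[of "Suc k"] l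
      by (intro block_deviation_prob_le[OF vc C X, where B = "b (Suc k)"])
         (auto simp: mono_def f_def)
    then show ?thesis using y_int by (simp add: B_def e_def f_eq)
  qed
  have "{\<omega>\<in>space M. \<exists>j<2 ^ m. \<bar>\<Sum>i\<in>{0<..j}. y m i \<omega> - e m i\<bar>
       > (\<Sum>k<m. l k + l (Suc k) + 2 ^ Suc k * D k)}
     \<subseteq> (\<Union>k<m. \<Union>q<2 ^ (m - k). A k q) \<union> (\<Union>k<m. \<Union>q<2 ^ (m - Suc k). B k q)" (is "?E \<subseteq> ?U")
  proof
    fix \<omega> assume "\<omega> \<in> ?E"
    then obtain j where \<omega>: "\<omega> \<in> space M" "j < 2 ^ m"
      "\<bar>\<Sum>i\<in>{0<..j}. y m i \<omega> - e m i\<bar> > (\<Sum>k<m. l k + l (Suc k) + 2 ^ Suc k * D k)" by blast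
    show "\<omega> \<in> ?U"
    proof (rule ccontr)
      assume U: "\<omega> \<notin> ?U"
      have nA: "\<bar>\<Sum>i\<in>{q * 2 ^ k<..q * 2 ^ k + 2 ^ k}. y k i \<omega> - e k i\<bar> \<le> l k"
        if "k < m" "q < 2 ^ (m - k)" for k q
      proof -
        have "\<omega> \<notin> A k q" using U that by blast
        with \<omega>(1) show ?thesis by (simp add: A_def not_less)
      qed
      have nB: "\<bar>\<Sum>i\<in>{q * 2 ^ Suc k<..q * 2 ^ Suc k + 2 ^ Suc k}.
          (y (Suc k) i \<omega> - y k i \<omega>) - (e (Suc k) i - e k i)\<bar> \<le> l (Suc k)"
        if "k < m" "q < 2 ^ (m - Suc k)" for k q
      proof -
        have "\<omega> \<notin> B k q" using U that by blast
        with \<omega>(1) show ?thesis by (simp add: B_def not_less)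
      qed
      have "\<bar>\<Sum>i\<in>{0<..j}. y m i \<omega> - e m i\<bar> \<le> (\<Sum>k<m. l k + l (Suc k) + 2 ^ Suc k * D k)"
        by (rule dyadic_chaining_bound[where y = "\<lambda>k i. y k i \<omega>", OF nA nB y_le e_le eD less_imp_le[OF l] \<omega>(2)])
      with \<omega>(3) show False by simp
    qed
  qed
  then have "prob ?E \<le> prob ?U" by (intro finite_measure_mono) auto
  also have "\<dots> \<le> prob (\<Union>k<m. \<Union>q<2 ^ (m - k). A k q) + prob (\<Union>k<m. \<Union>q<2 ^ (m - Suc k). B k q)"
    by (intro measure_Un_le) auto
  also have "prob (\<Union>k<m. \<Union>q<2 ^ (m - k). A k q) \<le> (\<Sum>k<m. \<Sum>q<2 ^ (m - k). prob (A k q))"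
    by (intro order.trans[OF finite_measure_subadditive_finite] sum_mono finite_measure_subadditive_finite) auto
  also have "\<dots> \<le> (\<Sum>k<m. \<Sum>q<(2::nat) ^ (m - k). C * real (2 ^ k) * V k / (l k)\<^sup>2)"
    by (intro sum_mono A)
  also have "\<dots> = (\<Sum>k<m. C * 2 ^ m * (V k / (l k)\<^sup>2))"
    by (intro sum.cong) (auto simp: power_add[symmetric])
  also have "\<dots> \<le> (\<Sum>k\<le>m. C * 2 ^ m * (V k / (l k)\<^sup>2))"
    using C V0 by (intro sum_mono2) auto
  also have "prob (\<Union>k<m. \<Union>q<2 ^ (m - Suc k). B k q) \<le> (\<Sum>k<m. \<Sum>q<2 ^ (m - Suc k). prob (B k q))"
    by (intro order.trans[OF finite_measure_subadditive_finite] sum_mono finite_measure_subadditive_finite) auto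
  also have "\<dots> \<le> (\<Sum>k<m. \<Sum>q<(2::nat) ^ (m - Suc k). C * real (2 ^ Suc k) * V (Suc k) / (l (Suc k))\<^sup>2)"
    by (intro sum_mono B)
  also have "\<dots> = (\<Sum>k<m. C * 2 ^ m * (V (Suc k) / (l (Suc k))\<^sup>2))"
  proof (intro sum.cong refl)
    fix k assume "k \<in> {..<m}"
    then have "(2::real) ^ m = 2 ^ (m - Suc k) * 2 ^ Suc k"
      using power_add[of "2::real" "m - Suc k" "Suc k"] by simp
    then show "(\<Sum>q<(2::nat) ^ (m - Suc k). C * real (2 ^ Suc k) * V (Suc k) / (l (Suc k))\<^sup>2) =
        C * 2 ^ m * (V (Suc k) / (l (Suc k))\<^sup>2)" by simp
  qed
  also have "\<dots> = (\<Sum>k\<in>Suc ` {..<m}. C * 2 ^ m * (V k / (l k)\<^sup>2))"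
    by (simp add: sum.reindex)
  also have "\<dots> \<le> (\<Sum>k\<le>m. C * 2 ^ m * (V k / (l k)\<^sup>2))"
    using C V0 by (intro sum_mono2) auto
  finally show ?thesis by (simp add: y_def e_def sum_distrib_left algebra_simps)
qed

end

subsection \<open>Summation over dyadic scales\<close>

lemma summable_geometric_convolution:
  fixes a :: "nat \<Rightarrow> real"
  assumes "summable a" "\<And>k. a k \<ge> 0" "0 \<le> r" "r < 1"
  shows "summable (\<lambda>m. \<Sum>k\<le>m. a k * r ^ (m - k))"
  using assms by (intro summable_Cauchy_product) (auto simp: summable_geometric)

text \<open>Exactly \<open>2 ^ m\<close> indices \<open>n \<ge> 1\<close> have
  \<open>floor_log n = m\<close>, and each of them contributes at most \<open>h m\<close> far
  out.\<close>

lemma summable_of_dyadic_blocks: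
  fixes g h :: "nat \<Rightarrow> real"
  assumes g: "\<forall>\<^sub>F n in sequentially. 0 \<le> g n \<and> g n \<le> h (floor_log n)"
    and h: "\<And>m. h m \<ge> 0" "summable (\<lambda>m. 2 ^ m * h m)"
  shows "summable (\<lambda>n. g (Suc n))"
proof -
  have block: "(\<Sum>n\<in>{1..<2 ^ M}. h (floor_log n)) = (\<Sum>m<M. 2 ^ m * h m)" for M
  proof (induction M)
    case (Suc M)
    have "floor_log n = M" if "n \<in> {2 ^ M..<2 ^ Suc M}" for n
      using that by (intro floor_log_eqI) auto
    then have "(\<Sum>n\<in>{2 ^ M..<2 ^ Suc M}. h (floor_log n)) = 2 ^ M * h M" by simp
    moreover have "(\<Sum>n\<in>{1..<2 ^ Suc M}. h (floor_log n)) =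
        (\<Sum>n\<in>{1..<2 ^ M}. h (floor_log n)) + (\<Sum>n\<in>{2 ^ M..<2 ^ Suc M}. h (floor_log n))"
      by (rule sum.atLeastLessThan_concat[symmetric]) auto
    ultimately show ?case using Suc by simp
  qed simp
  have "summable (\<lambda>n. h (floor_log (Suc n)))"
  proof (rule summableI_nonneg_bounded)
    fix N
    have "N < 2 ^ N" by (rule less_exp)
    have "(\<Sum>n<N. h (floor_log (Suc n))) = (\<Sum>n\<in>{1..<Suc N}. h (floor_log n))"
      by (simp only: One_nat_def sum.shift_bounds_Suc_ivl lessThan_atLeast0)
    also have "\<dots> \<le> (\<Sum>n\<in>{1..<2 ^ N}. h (floor_log n))"
      using h \<open>N < 2 ^ N\<close> by (intro sum_mono2 ivl_subset[THEN iffD2]) (auto simp: Suc_le_eq)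
    also have "\<dots> \<le> (\<Sum>m. 2 ^ m * h m)"
      unfolding block using h by (intro sum_le_suminf) auto
    finally show "(\<Sum>n<N. h (floor_log (Suc n))) \<le> (\<Sum>m. 2 ^ m * h m)" .
  qed (use h in auto)
  moreover have "\<forall>\<^sub>F n in sequentially. norm (g (Suc n)) \<le> h (floor_log (Suc n))"
    using g[THEN eventually_sequentially_Suc[THEN iffD2]] by eventually_elim auto
  ultimately show ?thesis by (rule summable_comparison_test_ev[rotated])
qed

text \<open>The weight times the \<open>2 ^ m\<close> of the union bounds is
  \<open>2 powr (m * \<tau>)\<close>, the normalisation in the hypotheses on tails and second
  moments. The growth condition with \<open>r\<close> makes the contribution of level
  \<open>k\<close> to the deviation at level \<open>m\<close> decay geometrically in
  \<open>m - k\<close>, and the one with \<open>s\<close> does so for the truncation bias. What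
  remains are convolutions of \<open>a\<close> with geometric sequences.\<close>

lemma (in prob_space) dyadic_maximal_deviation_summable:
  fixes X :: "nat \<Rightarrow> 'a \<Rightarrow> real" and a b :: "nat \<Rightarrow> real" and C \<tau> \<epsilon> r s :: real
  assumes vc: "variance_cond M X C" and C: "C \<ge> 0"
    and X[measurable]: "\<And>n. X n \<in> borel_measurable M"
    and X0: "\<And>n \<omega>. X n \<omega> \<ge> 0" and X_int: "\<And>n. integrable M (X n)"
    and b: "\<And>k. b k > 0" and a: "summable a"
    and P: "\<And>k i. i > 0 \<Longrightarrow> 2 powr (k * \<tau>) * prob {\<omega>\<in>space M. X i \<omega> > b k} \<le> a k"
    and V: "\<And>k i. i > 0 \<Longrightarrow> 2 powr (k * \<tau>) * expectation (\<lambda>\<omega>. (min (X i \<omega>) (b k))\<^sup>2) \<le> a k * (b k)\<^sup>2"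
    and D: "\<And>k i. i > 0 \<Longrightarrow> 2 ^ k * (expectation (X i) - expectation (\<lambda>\<omega>. min (X i \<omega>) (b k))) \<le> a k * b k"
    and r: "r < 1" "\<And>k. 2 powr \<tau> * (b k)\<^sup>2 \<le> r * (b (Suc k))\<^sup>2"
    and s: "s < 1" "\<And>k. b k \<le> s * b (Suc k)"
    and \<epsilon>: "\<epsilon> > 0"
  shows "summable (\<lambda>m. 2 powr (real m * (\<tau> - 1)) *
    prob {\<omega>\<in>space M. \<exists>j<2 ^ m. \<bar>\<Sum>i\<in>{0<..j}. X i \<omega> - expectation (X i)\<bar> > \<epsilon> * b m})"
proof -
  have a0: "a k \<ge> 0" for k
  proof -
    have "0 \<le> 2 powr (k * \<tau>) * prob {\<omega>\<in>space M. X 1 \<omega> > b k}" by simp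
    also have "\<dots> \<le> a k" by (rule P) simp
    finally show ?thesis .
  qed
  have r0: "r > 0"
  proof (rule ccontr)
    assume "\<not> r > 0"
    then have "r * (b 1)\<^sup>2 \<le> 0" by (simp add: mult_nonpos_nonneg)
    moreover have "2 powr \<tau> * (b 0)\<^sup>2 > 0" using b[of 0] by simp
    ultimately show False using r(2)[of 0] by simp
  qed
  have s0: "s > 0"
  proof (rule ccontr)
    assume "\<not> s > 0"
    then have "s * b 1 \<le> 0" using b[of 1] by (simp add: mult_nonpos_nonneg)
    then show False using s(2)[of 0] b[of 0] by simp
  qed
  have bS: "b k \<le> b (Suc k)" for k
    using s(2)[of k] mult_right_mono[of s 1 "b (Suc k)"] s(1) b[of "Suc k"] by linarith
  \<comment> \<open>Thresholds proportional to \<open>\<theta> ^ (m - k)\<close> enter Chebyshev's bound squared, so \<open>r / \<theta>\<^sup>2 < 1\<close> must survive.\<close>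
  define \<theta> where "\<theta> = sqrt (sqrt r)"
  have \<theta>: "0 < \<theta>" "\<theta> < 1" "\<theta>\<^sup>2 = sqrt r" "r / \<theta>\<^sup>2 = sqrt r"
    using r0 r(1) by (auto simp: \<theta>_def real_div_sqrt)
  \<comment> \<open>The budget: by the geometric series in \<open>\<theta>\<close> each of the two
    threshold sums takes at most \<open>\<epsilon> * b m / 4\<close>, and the other half of
    \<open>\<epsilon> * b m\<close> is left for the truncation bias.\<close>
  define \<eta> where "\<eta> = \<epsilon> * (1 - \<theta>) / 4"
  have \<eta>: "\<eta> > 0" using \<theta> \<epsilon> by (simp add: \<eta>_def)
  \<comment> \<open>The factor that Chebyshev's inequality produces for a threshold of order
    \<open>b m\<close>; the hypothesis on \<open>r\<close> says that it shrinks by \<open>r\<close>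
    from one level to the next.\<close>
  define c where "c m = 2 powr (real m * \<tau>) / (b m)\<^sup>2" for m
  have c0: "c m > 0" for m using b[of m] by (simp add: c_def)
  have c_Suc: "c (Suc m) \<le> r * c m" for m
    using r(2)[of m] b[of m] b[of "Suc m"]
    by (simp add: c_def field_simps distrib_right powr_add)
  have c_le: "c m \<le> r ^ (m - k) * c k" if "k \<le> m" for k m
    using that
  proof (induction m rule: dec_induct)
    case (step m)
    have "c (Suc m) \<le> r * c m" by (rule c_Suc)
    also have "\<dots> \<le> r * (r ^ (m - k) * c k)" using step r0 by (intro mult_left_mono) auto
    finally show ?case using step by (simp add: Suc_diff_le mult_ac)
  qed simp
  have b_le: "b k \<le> s ^ (m - k) * b m" if "k \<le> m" for k m
    using that
  proof (induction m rule: dec_induct)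
    case (step m)
    have "b k \<le> s ^ (m - k) * b m" by (rule step)
    also have "\<dots> \<le> s ^ (m - k) * (s * b (Suc m))" using s(2)[of m] s0 by (intro mult_left_mono) auto
    finally show ?case using step by (simp add: Suc_diff_le mult_ac)
  qed simp
  \<comment> \<open>\<open>W\<close> collects the Chebyshev bounds and \<open>U\<close> the
    truncation biases relative to \<open>b m\<close>. The first has to be summable, the second only
    eventually small.\<close>
  define W where "W m = (\<Sum>k\<le>m. a k * sqrt r ^ (m - k))" for m
  define U where "U m = (\<Sum>k\<le>m. a k * s ^ (m - k))" for m
  have W: "summable W" unfolding W_def using a a0 r0 r(1) by (intro summable_geometric_convolution) auto
  have "summable U" unfolding U_def using a a0 s0 s(1) by (intro summable_geometric_convolution) auto
  then have "U \<longlonglongrightarrow> 0" by (rule summable_LIMSEQ_zero)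
  then have U: "\<forall>\<^sub>F m in sequentially. U m < \<epsilon> / 4" using \<epsilon> by (intro order_tendstoD(2)) auto
  define V' where "V' k = a k * (b k)\<^sup>2 / 2 powr (k * \<tau>)" for k :: nat
  define D' where "D' k = a k * b k / 2 ^ k" for k
  have V': "expectation (\<lambda>\<omega>. (min (X i \<omega>) (b k))\<^sup>2) \<le> V' k" if "i > 0" for k i
    using V[OF that, of k] by (simp add: V'_def field_simps)
  have D': "expectation (X i) - expectation (\<lambda>\<omega>. min (X i \<omega>) (b k)) \<le> D' k" if "i > 0" for k i
    using D[OF that, of k] by (simp add: D'_def field_simps)
  let ?E = "\<lambda>m. {\<omega>\<in>space M. \<exists>j<2 ^ m. \<bar>\<Sum>i\<in>{0<..j}. X i \<omega> - expectation (X i)\<bar> > \<epsilon> * b m}"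
  have bound: "2 powr (real m * (\<tau> - 1)) * prob (?E m) \<le> a m + 2 * C / \<eta>\<^sup>2 * W m" if Um: "U m < \<epsilon> / 4" for m
  proof -
    define l where "l k = \<eta> * b m * \<theta> ^ (m - k)" for k
    have l0: "l k > 0" for k using \<eta> \<theta> b by (simp add: l_def)
    have "(\<Sum>k<m. \<theta> ^ (m - Suc k)) \<le> 1 / (1 - \<theta>)"
      using \<theta> unfolding sum.nat_diff_reindex by (simp add: sum_gp_strict divide_right_mono)
    then have "(\<Sum>k<m. l (Suc k)) \<le> \<eta> * b m * (1 / (1 - \<theta>))"
      unfolding l_def sum_distrib_left[symmetric] using \<eta> b[of m] by (intro mult_left_mono) auto
    also have "\<dots> = \<epsilon> * b m / 4"
    proof -
      have "1 - \<theta> \<noteq> 0" using \<theta> by simp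
      then show ?thesis unfolding \<eta>_def by (simp add: field_simps)
    qed
    finally have l_sum: "(\<Sum>k<m. l (Suc k)) \<le> \<epsilon> * b m / 4" .
    moreover have "(\<Sum>k<m. l k) \<le> (\<Sum>k<m. l (Suc k))"
      unfolding l_def using \<eta> b[of m] \<theta>
      by (intro sum_mono mult_left_mono power_decreasing) auto
    moreover have "(\<Sum>k<m. 2 ^ Suc k * D' k) + 2 ^ m * D' m \<le> 2 * (b m * U m)"
    proof -
      have "(\<Sum>k<m. 2 ^ Suc k * D' k) + 2 ^ m * D' m \<le> (\<Sum>k<m. 2 * (a k * b k)) + 2 * (a m * b m)"
        using a0[of m] b[of m] by (auto simp: D'_def intro!: add_mono sum_mono)
      also have "\<dots> = (\<Sum>k\<le>m. 2 * (a k * b k))" by (simp flip: lessThan_Suc_atMost)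
      also have "\<dots> \<le> (\<Sum>k\<le>m. 2 * (a k * (s ^ (m - k) * b m)))"
        using b_le a0 by (intro sum_mono mult_left_mono) auto
      also have "\<dots> = 2 * (b m * U m)" by (simp add: U_def sum_distrib_left mult_ac)
      finally show ?thesis .
    qed
    moreover have "b m * U m \<le> b m * (\<epsilon> / 4)" using Um b[of m] by (intro mult_left_mono) auto
    ultimately have total: "(\<Sum>k<m. l k + l (Suc k) + 2 ^ Suc k * D' k) + 2 ^ m * D' m \<le> \<epsilon> * b m"
      unfolding sum.distrib by (simp add: mult_ac)
    let ?T = "{\<omega>\<in>space M. \<exists>j<2 ^ m. \<bar>\<Sum>i\<in>{0<..j}. min (X i \<omega>) (b m) - expectation (\<lambda>\<omega>. min (X i \<omega>) (b m))\<bar>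
       > (\<Sum>k<m. l k + l (Suc k) + 2 ^ Suc k * D' k)}"
    \<comment> \<open>Off \<open>?A\<close> no variable with index below \<open>2 ^ m\<close>
      exceeds \<open>b m\<close>, so truncating at the top level changes only the centring. The
      change in the means is nonnegative and adds up to at most \<open>2 ^ m * D' m\<close>, which
      \<open>total\<close> includes.\<close>
    let ?A = "\<Union>i\<in>{0<..<2 ^ m}. {\<omega>\<in>space M. X i \<omega> > b m}"
    have "?E m \<subseteq> ?A \<union> ?T"
    proof
      fix \<omega> assume "\<omega> \<in> ?E m"
      then have "\<omega> \<in> space M" "\<exists>j<2 ^ m. \<bar>\<Sum>i\<in>{0<..j}. X i \<omega> - expectation (X i)\<bar> > \<epsilon> * b m"
        by simp_all
      then obtain j where \<omega>: "\<omega> \<in> space M" "j < 2 ^ m"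
          "\<bar>\<Sum>i\<in>{0<..j}. X i \<omega> - expectation (X i)\<bar> > \<epsilon> * b m"
        by (elim exE conjE) (rule that)
      show "\<omega> \<in> ?A \<union> ?T"
      proof (rule ccontr)
        assume U: "\<omega> \<notin> ?A \<union> ?T"
        let ?d = "\<lambda>i. expectation (X i) - expectation (\<lambda>\<omega>. min (X i \<omega>) (b m))"
        have "min (X i \<omega>) (b m) = X i \<omega>" if "i \<in> {0<..j}" for i
        proof -
          have "i \<in> {0<..<2 ^ m}" using \<omega>(2) that by simp
          then have "\<omega> \<notin> {\<omega>\<in>space M. X i \<omega> > b m}" using U by blast
          with \<omega>(1) show ?thesis by simp
        qed
        then have "(\<Sum>i\<in>{0<..j}. X i \<omega> - expectation (X i)) =
            (\<Sum>i\<in>{0<..j}. (min (X i \<omega>) (b m) - expectation (\<lambda>\<omega>. min (X i \<omega>) (b m))) - ?d i)"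
          by (intro sum.cong) auto
        moreover have "\<bar>\<Sum>i\<in>{0<..j}. min (X i \<omega>) (b m) - expectation (\<lambda>\<omega>. min (X i \<omega>) (b m))\<bar>
            \<le> (\<Sum>k<m. l k + l (Suc k) + 2 ^ Suc k * D' k)"
        proof -
          have "\<omega> \<notin> ?T" using U by blast
          then have "\<not> (\<exists>j<2 ^ m. \<bar>\<Sum>i\<in>{0<..j}. min (X i \<omega>) (b m) - expectation (\<lambda>\<omega>. min (X i \<omega>) (b m))\<bar>
            > (\<Sum>k<m. l k + l (Suc k) + 2 ^ Suc k * D' k))" using \<omega>(1) by simp
          with \<omega>(2) show ?thesis by (meson not_less)
        qed
        moreover have "0 \<le> sum ?d {0<..j}"
        proof (intro sum_nonneg)
          fix i
          have "integrable M (\<lambda>\<omega>. min (X i \<omega>) (b m))"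
            using integrable_min(1)[OF X X0] b[of m] by simp
          then show "0 \<le> ?d i" using X_int by (auto intro!: integral_mono)
        qed
        moreover have "sum ?d {0<..j} \<le> 2 ^ m * D' m"
        proof -
          have "sum ?d {0<..j} \<le> real j * D' m"
            using sum_bounded_above[of "{0<..j}" ?d "D' m"] D' by simp
          also have "\<dots> \<le> 2 ^ m * D' m"
          proof (rule mult_right_mono)
            have "real j < real (2 ^ m)" using \<omega>(2) by (simp only: of_nat_less_iff)
            then show "real j \<le> 2 ^ m" by simp
            show "D' m \<ge> 0" using a0[of m] b[of m] by (simp add: D'_def)
          qed
          finally show ?thesis .
        qed
        ultimately show False using total \<omega>(3) unfolding sum_subtractf[of _ ?d] by linarith
      qed
    qed
    then have "prob (?E m) \<le> prob (?A \<union> ?T)" by (intro finite_measure_mono) auto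
    also have "\<dots> \<le> prob ?A + prob ?T" by (intro measure_Un_le) auto
    also have "prob ?A \<le> (\<Sum>i\<in>{0<..<2 ^ m}. prob {\<omega>\<in>space M. X i \<omega> > b m})"
      by (intro finite_measure_subadditive_finite) auto
    also have "\<dots> \<le> 2 ^ m * (a m / 2 powr (m * \<tau>))"
    proof -
      have "(\<Sum>i\<in>{0<..<2 ^ m}. prob {\<omega>\<in>space M. X i \<omega> > b m}) \<le> real (card {0<..<(2::nat) ^ m}) * (a m / 2 powr (m * \<tau>))"
        using P by (intro sum_bounded_above) (auto simp: field_simps)
      also have "\<dots> \<le> 2 ^ m * (a m / 2 powr (m * \<tau>))"
        using a0[of m] by (intro mult_right_mono) (auto simp: of_nat_diff)
      finally show ?thesis .
    qed
    also have "prob ?T \<le> 2 * C * 2 ^ m * (\<Sum>k\<le>m. V' k / (l k)\<^sup>2)"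
      using V' D' l0 b bS by (intro truncated_maximal_inequality[OF vc C X X0 X_int]) (auto simp: incseq_Suc_iff)
    finally have "prob (?E m) \<le> 2 ^ m * (a m / 2 powr (m * \<tau>)) + 2 * C * 2 ^ m * (\<Sum>k\<le>m. V' k / (l k)\<^sup>2)"
      by simp
    then have "2 powr (real m * (\<tau> - 1)) * prob (?E m) \<le> 2 powr (real m * (\<tau> - 1)) *
        (2 ^ m * (a m / 2 powr (m * \<tau>)) + 2 * C * 2 ^ m * (\<Sum>k\<le>m. V' k / (l k)\<^sup>2))"
      by (intro mult_left_mono) auto
    also have "\<dots> = (2 powr (real m * (\<tau> - 1)) * 2 ^ m) *
        ((a m / 2 powr (m * \<tau>)) + 2 * C * (\<Sum>k\<le>m. V' k / (l k)\<^sup>2))"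
      by (simp add: algebra_simps)
    also have "2 powr (real m * (\<tau> - 1)) * 2 ^ m = 2 powr (m * \<tau>)"
      by (simp add: right_diff_distrib powr_diff powr_realpow)
    also have "2 powr (m * \<tau>) * ((a m / 2 powr (m * \<tau>)) + 2 * C * (\<Sum>k\<le>m. V' k / (l k)\<^sup>2))
        = a m + 2 * C * (\<Sum>k\<le>m. 2 powr (m * \<tau>) * (V' k / (l k)\<^sup>2))"
      by (simp add: field_simps sum_distrib_left)
    also have "(\<Sum>k\<le>m. 2 powr (m * \<tau>) * (V' k / (l k)\<^sup>2)) \<le> (\<Sum>k\<le>m. a k * sqrt r ^ (m - k) / \<eta>\<^sup>2)"
    proof (intro sum_mono)
      fix k assume "k \<in> {..m}"
      then have k: "k \<le> m" by simp
      \<comment> \<open>The ratio \<open>c m / c k\<close> supplies \<open>r ^ (m - k)\<close>,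
        while the squared thresholds cost \<open>(\<theta>\<^sup>2) ^ (m - k)\<close>; the choice of
        \<open>\<theta>\<close> leaves \<open>sqrt r ^ (m - k)\<close>.\<close>
      have "2 powr (m * \<tau>) * (V' k / (l k)\<^sup>2) = a k * (c m / c k) / (\<eta>\<^sup>2 * (\<theta>\<^sup>2) ^ (m - k))"
        using b[of m] b[of k] by (simp add: V'_def l_def c_def power_mult_distrib flip: power_mult) (simp add: mult_ac)
      also have "\<dots> \<le> a k * r ^ (m - k) / (\<eta>\<^sup>2 * (\<theta>\<^sup>2) ^ (m - k))"
        using c_le[OF k] c0[of k] a0[of k] by (intro divide_right_mono mult_left_mono) (auto simp: field_simps)
      also have "\<dots> = a k * (r / \<theta>\<^sup>2) ^ (m - k) / \<eta>\<^sup>2" by (simp add: power_divide)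
      finally show "2 powr (m * \<tau>) * (V' k / (l k)\<^sup>2) \<le> a k * sqrt r ^ (m - k) / \<eta>\<^sup>2" by (simp only: \<theta>(4))
    qed
    also have "(\<Sum>k\<le>m. a k * sqrt r ^ (m - k) / \<eta>\<^sup>2) = W m / \<eta>\<^sup>2"
      by (simp add: W_def sum_divide_distrib)
    finally show ?thesis using C by (simp add: mult_left_mono)
  qed
  show ?thesis
  proof (rule summable_comparison_test_ev)
    show "\<forall>\<^sub>F m in sequentially. norm (2 powr (real m * (\<tau> - 1)) * prob (?E m)) \<le> a m + 2 * C / \<eta>\<^sup>2 * W m"
      using U by eventually_elim (use bound in auto)
    show "summable (\<lambda>m. a m + 2 * C / \<eta>\<^sup>2 * W m)"
      using a W by (intro summable_add summable_mult)
  qed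
qed

subsection \<open>Consequences of the moment condition\<close>

text \<open>Far out the weight is \<open>x powr p\<close> times a normalised slowly varying
  function, so the three monotonicities rest on the exponents \<open>p > 0\<close>,
  \<open>p - 1\<close> and \<open>p - 2 < 0\<close>. At \<open>p = 1\<close> no power is left in
  \<open>\<phi> x / x\<close>, and the monotonicity of \<open>L\<close> itself takes over.\<close>

lemma weight_monotone:
  fixes L :: "real \<Rightarrow> real" and p :: real
  defines "\<phi> \<equiv> \<lambda>x. x powr p * L x powr p * logm x * (logm (logm x))\<^sup>2"
  assumes L: "normalized_slowly_varying L" and p: "1 \<le> p" "p < 2"
    and p1: "p = 1 \<Longrightarrow> mono_on {0..} L"
  shows "\<exists>x0>0. (\<forall>x\<ge>x0. \<phi> x > 0) \<and> mono_on {x0..} \<phi> \<and> mono_on {x0..} (\<lambda>x. \<phi> x / x) \<and>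
    antimono_on {x0..} (\<lambda>x. \<phi> x / x\<^sup>2)"
proof -
  define F where "F x = L x powr p * (ln x * (ln (ln x))\<^sup>2)" for x
  have F: "normalized_slowly_varying F"
    unfolding F_def by (intro normalized_slowly_varying_mult normalized_slowly_varying_powr
        normalized_slowly_varying_logs L)
  have "\<forall>\<^sub>F x in at_top. \<phi> x = x powr p * F x"
    using eventually_logm_eq_ln by eventually_elim (auto simp: \<phi>_def F_def)
  moreover note normalized_slowly_varyingD[OF F] normalized_slowly_varyingD[OF L]
    eventually_gt_at_top[of "exp 1 :: real"]
  ultimately have "\<forall>\<^sub>F x in at_top. \<phi> x = x powr p * F x \<and> F x > 0 \<and> L x > 0 \<and> x > exp 1"
    by eventually_elim auto
  then obtain B where B: "\<And>x. x \<ge> B \<Longrightarrow> \<phi> x = x powr p * F x \<and> F x > 0 \<and> L x > 0 \<and> x > exp 1"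
    unfolding eventually_at_top_linorder by blast
  obtain A1 where A1: "mono_on {A1..} (\<lambda>x. x powr p * F x)"
    using normalized_slowly_varying_mono[OF F, of p] p by auto
  obtain A2 where A2: "antimono_on {A2..} (\<lambda>x. x powr (-(2 - p)) * F x)"
    using normalized_slowly_varying_antimono[OF F, of "2 - p"] p by auto
  have "\<exists>A3\<ge>B. mono_on {A3..} (\<lambda>x. x powr (p - 1) * F x)"
  proof (cases "p = 1")
    case True
    have "mono_on {B..} (\<lambda>x. x powr (p - 1) * F x)"
    proof (rule mono_onI)
      fix x y assume xy: "x \<in> {B..}" "y \<in> {B..}" "x \<le> y"
      have "x > exp 1" "y > exp 1" "L x > 0" using B xy by auto
      then have x: "x > 0" "y > 0" and "L x > 0" using less_trans[OF exp_gt_zero] by blast+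
      have "ln x > ln (exp 1)" using \<open>x > exp 1\<close> x by (subst ln_less_cancel_iff) auto
      then have "ln x > 1" by simp
      have "L x \<le> L y" using p1[OF True] x xy by (auto intro: mono_onD)
      moreover have "ln x \<le> ln y" using x xy by simp
      moreover from this have "ln (ln x) \<le> ln (ln y)" using \<open>ln x > 1\<close> by simp
      moreover have "0 < ln (ln x)" using \<open>ln x > 1\<close> by simp
      ultimately have "F x \<le> F y"
        unfolding F_def using p \<open>L x > 0\<close> \<open>ln x > 1\<close>
        by (intro mult_mono powr_mono2 power_mono mult_nonneg_nonneg) auto
      then show "x powr (p - 1) * F x \<le> y powr (p - 1) * F y" using True x by simp
    qed
    then show ?thesis by blast
  next
    case False
    then obtain A where A: "mono_on {A..} (\<lambda>x. x powr (p - 1) * F x)"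
      using normalized_slowly_varying_mono[OF F, of "p - 1"] p by auto
    have "mono_on {max A B..} (\<lambda>x. x powr (p - 1) * F x)"
      using A by (rule mono_on_subset) auto
    then show ?thesis by (intro exI[of _ "max A B"]) auto
  qed
  then obtain A3 where A3: "mono_on {A3..} (\<lambda>x. x powr (p - 1) * F x)" by blast
  define x0 where "x0 = Max {1, B, A1, A2, A3}"
  have ge: "x \<ge> B" "x \<ge> A1" "x \<ge> A2" "x \<ge> A3" "x > 0" if "x \<ge> x0" for x
    using that by (auto simp: x0_def)
  have eq: "\<phi> x = x powr p * F x" "\<phi> x / x = x powr (p - 1) * F x"
    "\<phi> x / x\<^sup>2 = x powr (-(2 - p)) * F x" "F x > 0" if "x \<ge> x0" for x
    using B[OF ge(1)[OF that]] ge(5)[OF that]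
    by (auto simp: powr_diff powr_numeral)
  have "x0 > 0" by (rule ge(5)) simp
  moreover have "\<phi> x > 0" if "x \<ge> x0" for x
    using eq(1,4)[OF that] ge(5)[OF that] by simp
  moreover have "mono_on {x0..} \<phi>"
  proof (rule mono_onI)
    fix x y assume "x \<in> {x0..}" "y \<in> {x0..}" "x \<le> y"
    then show "\<phi> x \<le> \<phi> y" using mono_onD[OF A1, of x y] ge(2)[of x] ge(2)[of y] eq(1)[of x] eq(1)[of y] by simp
  qed
  moreover have "mono_on {x0..} (\<lambda>x. \<phi> x / x)"
  proof (rule mono_onI)
    fix x y assume "x \<in> {x0..}" "y \<in> {x0..}" "x \<le> y"
    then show "\<phi> x / x \<le> \<phi> y / y"
      using mono_onD[OF A3, of x y] ge(4)[of x] ge(4)[of y] eq(2)[of x] eq(2)[of y] by simp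
  qed
  moreover have "antimono_on {x0..} (\<lambda>x. \<phi> x / x\<^sup>2)"
  proof (rule monotone_onI)
    fix x y assume "x \<in> {x0..}" "y \<in> {x0..}" "x \<le> y"
    then show "\<phi> y / y\<^sup>2 \<le> \<phi> x / x\<^sup>2"
      using monotone_onD[OF A2, of x y] ge(3)[of x] ge(3)[of y] eq(3)[of x] eq(3)[of y] by simp
  qed
  ultimately show ?thesis by blast
qed

context prob_space
begin

text \<open>\<open>Y\<close> will be a positive or negative part and \<open>Z\<close> the absolute
  value that carries the moment. Growth of \<open>\<phi>\<close> gives the tail by Markov's
  inequality, decrease of \<open>\<phi> x / x\<^sup>2\<close> the truncated second moment, and
  growth of \<open>\<phi> x / x\<close> the mean beyond \<open>b\<close>.\<close>

lemma truncation_moment_bounds: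
  fixes Y Z :: "'a \<Rightarrow> real" and \<phi> :: "real \<Rightarrow> real"
  assumes [measurable]: "Y \<in> borel_measurable M" and Y_int: "integrable M Y"
    and Y: "\<And>\<omega>. 0 \<le> Y \<omega>" "\<And>\<omega>. Y \<omega> \<le> Z \<omega>"
    and \<phi>_int: "integrable M (\<lambda>\<omega>. \<phi> (Z \<omega>))" and \<phi>_K: "expectation (\<lambda>\<omega>. \<phi> (Z \<omega>)) \<le> K"
    and \<phi>0: "\<And>x. \<phi> x \<ge> 0" and x0: "x0 > 0" and pos: "\<And>x. x \<ge> x0 \<Longrightarrow> \<phi> x > 0"
    and mono: "mono_on {x0..} \<phi>" "mono_on {x0..} (\<lambda>x. \<phi> x / x)"
    and anti: "antimono_on {x0..} (\<lambda>x. \<phi> x / x\<^sup>2)" and b: "b \<ge> x0"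
  shows "prob {\<omega>\<in>space M. Y \<omega> > b} \<le> K / \<phi> b"
    and "expectation (\<lambda>\<omega>. (min (Y \<omega>) b)\<^sup>2) \<le> (K + \<phi> x0) * b\<^sup>2 / \<phi> b"
    and "expectation Y - expectation (\<lambda>\<omega>. min (Y \<omega>) b) \<le> K * b / \<phi> b"
proof -
  have b0: "b > 0" "\<phi> b > 0" using b x0 pos by auto
  have *: "x0 \<le> Z \<omega>" "Z \<omega> > 0" "\<phi> b \<le> \<phi> (Z \<omega>)" "\<phi> b / b \<le> \<phi> (Z \<omega>) / Z \<omega>" if "Y \<omega> > b" for \<omega>
    using that Y(2)[of \<omega>] b x0 mono_onD[OF mono(1), of b "Z \<omega>"] mono_onD[OF mono(2), of b "Z \<omega>"] by auto
  have "prob {\<omega>\<in>space M. Y \<omega> > b} = expectation (indicator {\<omega>\<in>space M. Y \<omega> > b})"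
    by simp
  also have "\<dots> \<le> expectation (\<lambda>\<omega>. \<phi> (Z \<omega>) / \<phi> b)"
    using \<phi>_int \<phi>0 b0 *(3)
    by (intro integral_mono integrable_real_indicator) (auto simp: indicator_def less_top[symmetric])
  also have "\<dots> \<le> K / \<phi> b" using \<phi>_K b0 by (simp add: divide_right_mono)
  finally show "prob {\<omega>\<in>space M. Y \<omega> > b} \<le> K / \<phi> b" .
  have min_int: "integrable M (\<lambda>\<omega>. min (Y \<omega>) b)" "integrable M (\<lambda>\<omega>. (min (Y \<omega>) b)\<^sup>2)"
    using integrable_min[of Y b] Y(1) b0(1) by auto
  \<comment> \<open>Below \<open>x0\<close> the shape of \<open>\<phi>\<close> is not controlled,
    hence the additive \<open>x0\<^sup>2\<close>. Otherwise \<open>\<phi>\<close> is compared at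
    \<open>min (Z \<omega>) b\<close>, which dominates the truncation of \<open>Y\<close> and stays
    in the monotone range.\<close>
  have sq: "(min (Y \<omega>) b)\<^sup>2 \<le> x0\<^sup>2 + \<phi> (Z \<omega>) * (b\<^sup>2 / \<phi> b)" for \<omega>
  proof (cases "min (Z \<omega>) b \<le> x0")
    case True
    then have "(min (Y \<omega>) b)\<^sup>2 \<le> x0\<^sup>2" using Y[of \<omega>] b0 by (intro power_mono) auto
    also have "\<dots> \<le> x0\<^sup>2 + \<phi> (Z \<omega>) * (b\<^sup>2 / \<phi> b)" using \<phi>0 b0 by simp
    finally show ?thesis .
  next
    case False
    define u where "u = min (Z \<omega>) b"
    have u: "u \<ge> x0" "u > 0" "u \<le> b" "u \<le> Z \<omega>" using False x0 by (auto simp: u_def)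
    have "\<phi> b / b\<^sup>2 \<le> \<phi> u / u\<^sup>2" using monotone_onD[OF anti, of u b] u b by simp
    then have "u\<^sup>2 \<le> \<phi> u * (b\<^sup>2 / \<phi> b)" using b0 u by (simp add: field_simps)
    also have "\<dots> \<le> \<phi> (Z \<omega>) * (b\<^sup>2 / \<phi> b)"
      using mono_onD[OF mono(1), of u "Z \<omega>"] u b0 by (intro mult_right_mono) auto
    finally have "u\<^sup>2 \<le> x0\<^sup>2 + \<phi> (Z \<omega>) * (b\<^sup>2 / \<phi> b)" by (simp add: add_increasing)
    moreover have "(min (Y \<omega>) b)\<^sup>2 \<le> u\<^sup>2" using Y[of \<omega>] b0 by (intro power_mono) (auto simp: u_def)
    ultimately show ?thesis by simp
  qed
  have "expectation (\<lambda>\<omega>. (min (Y \<omega>) b)\<^sup>2) \<le> expectation (\<lambda>\<omega>. x0\<^sup>2 + \<phi> (Z \<omega>) * (b\<^sup>2 / \<phi> b))"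
    using min_int \<phi>_int sq by (intro integral_mono) auto
  also have "\<dots> = x0\<^sup>2 + expectation (\<lambda>\<omega>. \<phi> (Z \<omega>)) * (b\<^sup>2 / \<phi> b)"
    using \<phi>_int by (simp add: prob_space)
  \<comment> \<open>The additive constant is absorbed by comparing \<open>x0\<close> with
    \<open>b\<close>, so that this bound also has the denominator \<open>\<phi> b\<close>.\<close>
  also have "\<dots> \<le> \<phi> x0 * (b\<^sup>2 / \<phi> b) + K * (b\<^sup>2 / \<phi> b)"
  proof (intro add_mono mult_right_mono \<phi>_K)
    have "\<phi> b / b\<^sup>2 \<le> \<phi> x0 / x0\<^sup>2" using monotone_onD[OF anti, of x0 b] b by simp
    then show "x0\<^sup>2 \<le> \<phi> x0 * (b\<^sup>2 / \<phi> b)" using b0 x0 by (simp add: field_simps)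
  qed (use b0 in auto)
  finally show "expectation (\<lambda>\<omega>. (min (Y \<omega>) b)\<^sup>2) \<le> (K + \<phi> x0) * b\<^sup>2 / \<phi> b"
    by (simp add: distrib_right add_divide_distrib)
  have tail: "Y \<omega> - min (Y \<omega>) b \<le> \<phi> (Z \<omega>) * (b / \<phi> b)" for \<omega>
  proof (cases "Y \<omega> > b")
    case True
    have "Z \<omega> \<le> \<phi> (Z \<omega>) * (b / \<phi> b)" using *[OF True] b0 by (simp add: field_simps)
    with True Y(2)[of \<omega>] b0 show ?thesis by auto
  qed (use \<phi>0 b0 in \<open>simp add: min_def\<close>)
  have "expectation Y - expectation (\<lambda>\<omega>. min (Y \<omega>) b) = expectation (\<lambda>\<omega>. Y \<omega> - min (Y \<omega>) b)"
    using Y_int min_int by simp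
  also have "\<dots> \<le> expectation (\<lambda>\<omega>. \<phi> (Z \<omega>) * (b / \<phi> b))"
    using Y_int min_int \<phi>_int tail by (intro integral_mono) auto
  also have "\<dots> = expectation (\<lambda>\<omega>. \<phi> (Z \<omega>)) * (b / \<phi> b)" using \<phi>_int by simp
  also have "\<dots> \<le> K * (b / \<phi> b)" using \<phi>_K b0 by (intro mult_right_mono) auto
  finally show "expectation Y - expectation (\<lambda>\<omega>. min (Y \<omega>) b) \<le> K * b / \<phi> b" by simp
qed

section \<open>Stability of the variance condition\<close>

lemma variance_cond_mono_comp:
  assumes "variance_cond M X C" and g: "mono g"
  shows "variance_cond M (\<lambda>n \<omega>. g (X n \<omega>)) C"
  unfolding variance_cond_def
proof (intro allI impI)
  fix k l :: nat and f :: "nat \<Rightarrow> real \<Rightarrow> real"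
  assume l: "l \<ge> 1" and f: "\<forall>i\<ge>1. mono (f i)"
    and int: "\<forall>i\<in>{k + 1..k + l}. integrable M (\<lambda>\<omega>. (f i (g (X i \<omega>)))\<^sup>2)"
  show "variance (\<lambda>\<omega>. \<Sum>i\<in>{k + 1..k + l}. f i (g (X i \<omega>)))
      \<le> C * (\<Sum>i\<in>{k + 1..k + l}. variance (\<lambda>\<omega>. f i (g (X i \<omega>))))"
    by (rule assms(1)[unfolded variance_cond_def, rule_format, of l "\<lambda>i x. f i (g x)" k])
       (use l f g int in \<open>auto simp: mono_def\<close>)
qed

lemma variance_uminus:
  fixes Y :: "'a \<Rightarrow> real"
  shows "variance (\<lambda>\<omega>. - Y \<omega>) = variance Y"
  by (simp add: power2_commute)

text \<open>A nondecreasing function of \<open>- X n\<close> is minus the nondecreasing function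
  \<open>- f (- x)\<close> of \<open>X n\<close>, and variances ignore the sign. This gives access
  to negative parts.\<close>

lemma variance_cond_uminus:
  assumes "variance_cond M X C"
  shows "variance_cond M (\<lambda>n \<omega>. - X n \<omega>) C"
  unfolding variance_cond_def
proof (intro allI impI)
  fix k l :: nat and f :: "nat \<Rightarrow> real \<Rightarrow> real"
  assume l: "l \<ge> 1" and f: "\<forall>i\<ge>1. mono (f i)"
    and int: "\<forall>i\<in>{k + 1..k + l}. integrable M (\<lambda>\<omega>. (f i (- X i \<omega>))\<^sup>2)"
  have "variance (\<lambda>\<omega>. \<Sum>i\<in>{k + 1..k + l}. - f i (- X i \<omega>))
      \<le> C * (\<Sum>i\<in>{k + 1..k + l}. variance (\<lambda>\<omega>. - f i (- X i \<omega>)))"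
    by (rule assms(1)[unfolded variance_cond_def, rule_format, of l "\<lambda>i x. - f i (- x)" k])
       (use l f int in \<open>auto simp: mono_def\<close>)
  then show "variance (\<lambda>\<omega>. \<Sum>i\<in>{k + 1..k + l}. f i (- X i \<omega>))
      \<le> C * (\<Sum>i\<in>{k + 1..k + l}. variance (\<lambda>\<omega>. f i (- X i \<omega>)))"
    by (simp only: sum_negf variance_uminus)
qed

text \<open>The sign of \<open>C\<close> is left open in the theorem; this allows passing to
  \<open>max C 0\<close>.\<close>

lemma variance_cond_mono:
  assumes "variance_cond M X C" "C \<le> C'"
  shows "variance_cond M X C'"
  unfolding variance_cond_def
proof (intro allI impI)
  fix k l :: nat and f :: "nat \<Rightarrow> real \<Rightarrow> real"
  assume "l \<ge> 1" "\<forall>i\<ge>1. mono (f i)" "\<forall>i\<in>{k + 1..k + l}. integrable M (\<lambda>\<omega>. (f i (X i \<omega>))\<^sup>2)"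
  then have "variance (\<lambda>\<omega>. \<Sum>i\<in>{k + 1..k + l}. f i (X i \<omega>))
      \<le> C * (\<Sum>i\<in>{k + 1..k + l}. variance (\<lambda>\<omega>. f i (X i \<omega>)))"
    using assms(1) unfolding variance_cond_def by simp
  also have "\<dots> \<le> C' * (\<Sum>i\<in>{k + 1..k + l}. variance (\<lambda>\<omega>. f i (X i \<omega>)))"
    using assms(2) by (intro mult_right_mono sum_nonneg) auto
  finally show "variance (\<lambda>\<omega>. \<Sum>i\<in>{k + 1..k + l}. f i (X i \<omega>))
      \<le> C' * (\<Sum>i\<in>{k + 1..k + l}. variance (\<lambda>\<omega>. f i (X i \<omega>)))" .
qed

end

section \<open>Normalising constants along powers of two\<close>

lemma de_bruijn_conjugate_dyadic_ratio:
  fixes \<alpha> q :: real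
  assumes Lt: "slowly_varying Lt" and \<alpha>: "\<alpha> > 0" and q: "q < \<alpha>"
    and y: "filterlim (\<lambda>x. x * Lt x) at_top at_top"
  defines "w \<equiv> \<lambda>k::nat. 2 powr (real k * \<alpha>) * Lt (2 powr (real k * \<alpha>))"
  shows "\<forall>\<^sub>F k in sequentially. 2 powr q * w k \<le> w (Suc k)"
proof -
  have x: "filterlim (\<lambda>k::nat. 2 powr (real k * \<alpha>)) at_top sequentially"
    using \<alpha> by real_asymp
  \<comment> \<open>Slow variation with the fixed factor \<open>2 powr \<alpha>\<close> makes the
    ratio of consecutive \<open>w\<close> tend to \<open>2 powr \<alpha>\<close>; any
    \<open>q < \<alpha>\<close> leaves room below this limit.\<close>
  have "(\<lambda>k. Lt (2 powr \<alpha> * 2 powr (real k * \<alpha>)) / Lt (2 powr (real k * \<alpha>))) \<longlonglongrightarrow> 1"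
    by (rule filterlim_compose[OF slowly_varying_tendsto[OF Lt] x]) simp
  moreover have "2 powr (q - \<alpha>) < (1 :: real)" using q powr_less_mono[of "q - \<alpha>" 0 2] by simp
  ultimately have "\<forall>\<^sub>F k in sequentially.
      2 powr (q - \<alpha>) < Lt (2 powr \<alpha> * 2 powr (real k * \<alpha>)) / Lt (2 powr (real k * \<alpha>))"
    by (rule order_tendstoD)
  moreover have "\<forall>\<^sub>F k in sequentially. Lt (2 powr (real k * \<alpha>)) > 0"
    by (rule eventually_compose_filterlim[OF slowly_varying_eventually_pos[OF Lt] x])
  ultimately show ?thesis
  proof eventually_elim
    case (elim k)
    define x where "x = 2 powr (real k * \<alpha>)"
    have Suc: "2 powr (real (Suc k) * \<alpha>) = 2 powr \<alpha> * x"
      by (simp add: x_def distrib_right powr_add)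
    have "2 powr (q - \<alpha>) * Lt x \<le> Lt (2 powr \<alpha> * x)"
      using elim by (simp add: x_def field_simps)
    then have "2 powr \<alpha> * x * (2 powr (q - \<alpha>) * Lt x) \<le> 2 powr \<alpha> * x * Lt (2 powr \<alpha> * x)"
      by (intro mult_left_mono) (auto simp: x_def)
    moreover have "2 powr \<alpha> * x * (2 powr (q - \<alpha>) * Lt x) = 2 powr q * (x * Lt x)"
      by (simp add: powr_diff)
    ultimately have "2 powr q * (x * Lt x) \<le> 2 powr \<alpha> * x * Lt (2 powr \<alpha> * x)" by (simp only:)
    then show ?case by (simp only: w_def Suc x_def[symmetric])
  qed
qed

text \<open>Since \<open>w k * L (w k)\<close> is asymptotic to
  \<open>2 powr (k * \<alpha>)\<close>, the power part of \<open>\<phi>\<close> cancels the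
  numerator up to a constant. Only the logarithms remain, and \<open>ln (w k)\<close> grows at least
  linearly in \<open>k\<close>, so the series of \<open>1 / (k * (ln k)\<^sup>2)\<close>
  dominates.\<close>

lemma summable_weight_at_conjugate:
  fixes L Lt :: "real \<Rightarrow> real" and p \<alpha> :: real
  assumes L: "slowly_varying L" and S: "standing_S L Lt" and conj: "de_bruijn_conjugate L Lt"
    and p: "p > 0" and \<alpha>: "\<alpha> > 0"
  defines "\<phi> \<equiv> \<lambda>x. x powr p * L x powr p * logm x * (logm (logm x))\<^sup>2"
    and "w \<equiv> \<lambda>k::nat. 2 powr (real k * \<alpha>) * Lt (2 powr (real k * \<alpha>))"
  shows "summable (\<lambda>k. 2 powr (real k * (\<alpha> * p)) / \<phi> (w k))"
proof -
  \<comment> \<open>\<open>c * real k\<close> is the logarithm of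
    \<open>(2 powr (real k * \<alpha>)) powr (1 / 4)\<close>, the lower bound for
    \<open>w k\<close>.\<close>
  define c where "c = \<alpha> * ln 2 / 4"
  have c: "c > 0" using \<alpha> by (simp add: c_def)
  have x: "filterlim (\<lambda>k::nat. 2 powr (real k * \<alpha>)) at_top sequentially"
    using \<alpha> by real_asymp
  have w: "filterlim w at_top sequentially"
    unfolding w_def by (rule filterlim_compose[OF de_bruijn_conjugate_at_top[OF S conj] x])
  have "\<forall>\<^sub>F x in at_top. x * Lt x * L (x * Lt x) / x > 1 / 2"
    by (rule order_tendstoD[OF de_bruijn_inverse_tendsto[OF conj]]) simp
  then have "\<forall>\<^sub>F k in sequentially. w k * L (w k) / 2 powr (real k * \<alpha>) > 1 / 2"
    unfolding w_def by (rule eventually_compose_filterlim[OF _ x])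
  moreover have "\<forall>\<^sub>F k in sequentially. (2 powr (real k * \<alpha>)) powr (1 / 4) \<le> w k"
    unfolding w_def by (rule eventually_compose_filterlim[OF de_bruijn_powr_lower_bound[OF L S conj] x])
  moreover have "\<forall>\<^sub>F k in sequentially. logm (w k) = ln (w k) \<and> logm (ln (w k)) = ln (ln (w k))"
    by (rule eventually_compose_filterlim[OF eventually_logm_eq_ln w])
  moreover have "\<forall>\<^sub>F k in sequentially. L (w k) > 0"
    by (rule eventually_compose_filterlim[OF slowly_varying_eventually_pos[OF L] w])
  \<comment> \<open>From here on \<open>ln (c * real k)\<close> is positive, so the comparison of
    iterated logarithms may be squared.\<close>
  moreover have "\<forall>\<^sub>F k in sequentially. c * real k > 1"
    using c by real_asymp
  moreover have "\<forall>\<^sub>F k in sequentially. w k > 0"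
    by (rule eventually_compose_filterlim[OF eventually_gt_at_top w])
  ultimately have "\<forall>\<^sub>F k in sequentially. norm (2 powr (real k * (\<alpha> * p)) / \<phi> (w k))
      \<le> 2 powr p * (1 / (c * real k * (ln (c * real k))\<^sup>2))"
  proof eventually_elim
    case (elim k)
    define v where "v = c * real k"
    have "ln ((2 powr (real k * \<alpha>)) powr (1 / 4)) \<le> ln (w k)"
      using elim by (subst ln_le_cancel_iff) auto
    then have v: "v \<le> ln (w k)" "v > 1"
      using elim by (auto simp: ln_powr v_def c_def powr_powr mult_ac)
    have "0 < ln v" "ln v \<le> ln (ln (w k))" using v by auto
    then have logs: "v * (ln v)\<^sup>2 \<le> ln (w k) * (ln (ln (w k)))\<^sup>2" "v * (ln v)\<^sup>2 > 0"
      using v by (auto intro!: mult_mono power_mono)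
    have "2 powr (real k * (\<alpha> * p)) = (2 powr (real k * \<alpha>)) powr p"
      by (simp add: powr_powr mult.assoc)
    also have "\<dots> \<le> (2 * (w k * L (w k))) powr p"
      using elim p by (intro powr_mono2) (auto simp: field_simps)
    also have "\<dots> = 2 powr p * (w k powr p * L (w k) powr p)"
      using elim by (simp add: powr_mult)
    finally have num: "2 powr (real k * (\<alpha> * p)) \<le> 2 powr p * (w k powr p * L (w k) powr p)" .
    have \<phi>: "\<phi> (w k) = (w k powr p * L (w k) powr p) * (ln (w k) * (ln (ln (w k)))\<^sup>2)"
      using elim by (simp add: \<phi>_def)
    have "2 powr (real k * (\<alpha> * p)) / \<phi> (w k)
        \<le> 2 powr p * (w k powr p * L (w k) powr p) / ((w k powr p * L (w k) powr p) * (v * (ln v)\<^sup>2))"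
      unfolding \<phi> using num logs v elim by (intro frac_le mult_left_mono mult_pos_pos) auto
    also have "\<dots> = 2 powr p * (1 / (v * (ln v)\<^sup>2))"
      using elim by simp
    finally have "2 powr (real k * (\<alpha> * p)) / \<phi> (w k) \<le> 2 powr p * (1 / (v * (ln v)\<^sup>2))" .
    moreover have "\<phi> (w k) > 0"
    proof -
      have "0 < ln (w k) * (ln (ln (w k)))\<^sup>2" using logs by linarith
      moreover have "w k powr p * L (w k) powr p > 0" using elim by simp
      ultimately show ?thesis unfolding \<phi> by (rule mult_pos_pos[rotated])
    qed
    ultimately show ?case by (simp add: v_def)
  qed
  moreover have "summable (\<lambda>k. 2 powr p * (1 / (c * real k * (ln (c * real k))\<^sup>2)))"
    by (intro summable_mult summable_comparison_test_bigo[OF _ inverse_n_ln_squared_scale_bigo[OF c]])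
       (use summable_inverse_n_ln_squared in \<open>simp add: abs_mult\<close>)
  ultimately show ?thesis by (rule summable_comparison_test_ev)
qed

lemma (in prob_space) weighted_deviation_summable:
  fixes Y Z :: "nat \<Rightarrow> 'a \<Rightarrow> real" and b :: "nat \<Rightarrow> real" and \<phi> :: "real \<Rightarrow> real" and C \<tau> \<epsilon> r s K x0 :: real
  assumes vc: "variance_cond M Y C" and C: "C \<ge> 0"
    and Y_int: "\<And>n. integrable M (Y n)"
    and Y: "\<And>n \<omega>. 0 \<le> Y n \<omega>" "\<And>n \<omega>. Y n \<omega> \<le> Z n \<omega>"
    and \<phi>_int: "\<And>n. n > 0 \<Longrightarrow> integrable M (\<lambda>\<omega>. \<phi> (Z n \<omega>))"
    and \<phi>_K: "\<And>n. n > 0 \<Longrightarrow> expectation (\<lambda>\<omega>. \<phi> (Z n \<omega>)) \<le> K"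
    and \<phi>0: "\<And>x. \<phi> x \<ge> 0" and x0: "x0 > 0" and pos: "\<And>x. x \<ge> x0 \<Longrightarrow> \<phi> x > 0"
    and mono: "mono_on {x0..} \<phi>" "mono_on {x0..} (\<lambda>x. \<phi> x / x)"
    and anti: "antimono_on {x0..} (\<lambda>x. \<phi> x / x\<^sup>2)" and b: "\<And>k. b k \<ge> x0"
    and sum: "summable (\<lambda>k. 2 powr (real k * \<tau>) / \<phi> (b k))" and \<tau>: "\<tau> \<ge> 1"
    and r: "r < 1" "\<And>k. 2 powr \<tau> * (b k)\<^sup>2 \<le> r * (b (Suc k))\<^sup>2"
    and s: "s < 1" "\<And>k. b k \<le> s * b (Suc k)"
    and \<epsilon>: "\<epsilon> > 0"
  shows "summable (\<lambda>m. 2 powr (real m * (\<tau> - 1)) *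
    prob {\<omega>\<in>space M. \<exists>j<2 ^ m. \<bar>\<Sum>i\<in>{0<..j}. Y i \<omega> - expectation (Y i)\<bar> > \<epsilon> * b m})"
proof -
  \<comment> \<open>One sequence serves tails, second moments and means; the summand
    \<open>\<phi> x0\<close> comes from the second moments.\<close>
  define a where "a k = (K + \<phi> x0) * (2 powr (real k * \<tau>) / \<phi> (b k))" for k
  note B = truncation_moment_bounds[OF borel_measurable_integrable[OF Y_int] Y_int Y \<phi>_int \<phi>_K \<phi>0 x0 pos mono anti b]
  have K: "K \<ge> 0"
    by (rule order.trans[OF Bochner_Integration.integral_nonneg \<phi>_K[of 1]]) (use \<phi>0 in auto)
  have bp: "b k > 0" "\<phi> (b k) > 0" for k using b[of k] x0 pos[OF b] by auto
  have K_le: "K \<le> K + \<phi> x0" using \<phi>0 by simp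
  show ?thesis
  proof (rule dyadic_maximal_deviation_summable[where a = a and b = b and r = r and s = s, OF vc C _ Y(1) Y_int bp(1) _ _ _ _ r s \<epsilon>])
    show "Y n \<in> borel_measurable M" for n using Y_int by (rule borel_measurable_integrable)
    show "summable a" unfolding a_def by (intro summable_mult sum)
  next
    fix k i :: nat assume i: "i > 0"
    have "prob {\<omega>\<in>space M. b k < Y i \<omega>} \<le> K / \<phi> (b k)" by (rule B(1)[OF i i])
    also have "\<dots> \<le> (K + \<phi> x0) / \<phi> (b k)" using K_le bp(2)[of k] by (intro divide_right_mono) auto
    finally have "2 powr (real k * \<tau>) * prob {\<omega>\<in>space M. b k < Y i \<omega>} \<le> 2 powr (real k * \<tau>) * ((K + \<phi> x0) / \<phi> (b k))"
      by (intro mult_left_mono) auto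
    then show "2 powr (real k * \<tau>) * prob {\<omega>\<in>space M. b k < Y i \<omega>} \<le> a k"
      by (simp add: a_def mult_ac)
    have "2 powr (real k * \<tau>) * expectation (\<lambda>\<omega>. (min (Y i \<omega>) (b k))\<^sup>2) \<le>
        2 powr (real k * \<tau>) * ((K + \<phi> x0) * (b k)\<^sup>2 / \<phi> (b k))"
      by (intro mult_left_mono B(2)[OF i i]) auto
    then show "2 powr (real k * \<tau>) * expectation (\<lambda>\<omega>. (min (Y i \<omega>) (b k))\<^sup>2) \<le> a k * (b k)\<^sup>2"
      by (simp add: a_def mult_ac)
    have "expectation (Y i) - expectation (\<lambda>\<omega>. min (Y i \<omega>) (b k)) \<le> K * b k / \<phi> (b k)"
      by (rule B(3)[OF i i])
    also have "\<dots> \<le> (K + \<phi> x0) * b k / \<phi> (b k)"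
      using K_le bp[of k] by (intro divide_right_mono mult_right_mono) auto
    finally have "2 ^ k * (expectation (Y i) - expectation (\<lambda>\<omega>. min (Y i \<omega>) (b k))) \<le> 2 ^ k * ((K + \<phi> x0) * b k / \<phi> (b k))"
      by (intro mult_left_mono) auto
    \<comment> \<open>The means carry only \<open>2 ^ k\<close>. The assumption
      \<open>\<tau> \<ge> 1\<close>, that is \<open>\<alpha> \<ge> 1 / p\<close>, raises this to the
      common normalisation.\<close>
    also have "\<dots> \<le> 2 powr (real k * \<tau>) * ((K + \<phi> x0) * b k / \<phi> (b k))"
    proof (intro mult_right_mono)
      have "(2::real) ^ k = 2 powr (real k * 1)" by (simp add: powr_realpow)
      also have "\<dots> \<le> 2 powr (real k * \<tau>)" using \<tau> by (intro powr_mono mult_left_mono) auto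
      finally show "2 ^ k \<le> 2 powr (real k * \<tau>)" .
      show "0 \<le> (K + \<phi> x0) * b k / \<phi> (b k)" using K \<phi>0[of x0] bp[of k] by simp
    qed
    finally show "2 ^ k * (expectation (Y i) - expectation (\<lambda>\<omega>. min (Y i \<omega>) (b k))) \<le> a k * b k"
      by (simp add: a_def mult_ac)
  qed
qed

section \<open>From powers of two to all indices, and from parts to signed variables\<close>

lemma logm_ge_1: "logm x \<ge> 1"
proof -
  have "ln (exp 1) \<le> ln (max x (exp 1))" by (subst ln_le_cancel_iff) (auto simp: less_max_iff_disj)
  then show ?thesis by (simp add: logm_def)
qed

text \<open>The quotient of \<open>n\<close> by \<open>2 ^ floor_log n\<close> lies between 1 and 2.
  The absolute value of the exponent covers both signs, since \<open>\<alpha> * p - 2\<close> may be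
  negative.\<close>

lemma powr_dyadic_le:
  fixes n :: nat
  assumes "n > 0"
  shows "real n powr s \<le> 2 powr \<bar>s\<bar> * 2 powr (real (floor_log n) * s)"
proof -
  define m where "m = floor_log n"
  define t where "t = real n / 2 ^ m"
  have "2 ^ m \<le> n" unfolding m_def using assms by (intro floor_log_exp2_le) auto
  then have "real (2 ^ m) \<le> real n" by (simp only: of_nat_le_iff)
  then have t1: "1 \<le> t" by (simp add: t_def)
  have "n < 2 ^ Suc m" using floor_log_exp2_gt[of n] by (simp add: m_def)
  then have "real n < real (2 ^ Suc m)" by (simp only: of_nat_less_iff)
  then have t2: "t \<le> 2" by (simp add: t_def field_simps)
  have "real n = t * 2 powr real m" by (simp add: t_def powr_realpow)
  then have "real n powr s = t powr s * 2 powr (real m * s)"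
    using t1 by (simp add: powr_mult powr_powr)
  also have "t powr s \<le> t powr \<bar>s\<bar>" using t1 by (intro powr_mono) auto
  also have "\<dots> \<le> 2 powr \<bar>s\<bar>" using t1 t2 by (intro powr_mono2) auto
  finally show ?thesis by (simp add: m_def)
qed

text \<open>The truncation argument works with nonnegative variables, so the two parts are treated
  separately with half the threshold each; the negative part enters as the positive part of
  \<open>- X i\<close>.\<close>

lemma (in prob_space) deviation_summable_signed:
  fixes X :: "nat \<Rightarrow> 'a \<Rightarrow> real" and b c :: "nat \<Rightarrow> real"
  assumes X_int: "\<And>n. integrable M (X n)" and c: "\<And>m. c m \<ge> 0"
    and pos: "summable (\<lambda>m. c m * prob {\<omega>\<in>space M. \<exists>j<2 ^ m.
      \<bar>\<Sum>i\<in>{0<..j}. max (X i \<omega>) 0 - expectation (\<lambda>\<omega>. max (X i \<omega>) 0)\<bar> > \<epsilon> / 2 * b m})"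
    and neg: "summable (\<lambda>m. c m * prob {\<omega>\<in>space M. \<exists>j<2 ^ m.
      \<bar>\<Sum>i\<in>{0<..j}. max (- X i \<omega>) 0 - expectation (\<lambda>\<omega>. max (- X i \<omega>) 0)\<bar> > \<epsilon> / 2 * b m})"
  shows "summable (\<lambda>m. c m * prob {\<omega>\<in>space M. \<exists>j<2 ^ m.
      \<bar>\<Sum>i\<in>{0<..j}. X i \<omega> - expectation (X i)\<bar> > \<epsilon> * b m})"
proof (rule summable_comparison_test[OF exI, OF allI, OF impI])
  fix m :: nat
  define P where "P i \<omega> = max (X i \<omega>) 0 - expectation (\<lambda>\<omega>. max (X i \<omega>) 0)" for i \<omega>
  define N where "N i \<omega> = max (- X i \<omega>) 0 - expectation (\<lambda>\<omega>. max (- X i \<omega>) 0)" for i \<omega>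
  have [measurable]: "X i \<in> borel_measurable M" for i using X_int by (rule borel_measurable_integrable)
  have int: "integrable M (\<lambda>\<omega>. max (X i \<omega>) 0)" "integrable M (\<lambda>\<omega>. max (- X i \<omega>) 0)" for i
    using X_int by auto
  have eq: "X i \<omega> - expectation (X i) = P i \<omega> - N i \<omega>" for i \<omega>
  proof -
    have "X i = (\<lambda>\<omega>. max (X i \<omega>) 0 - max (- X i \<omega>) 0)" by (auto simp: max_def)
    then have "expectation (X i) = expectation (\<lambda>\<omega>. max (X i \<omega>) 0 - max (- X i \<omega>) 0)" by (rule arg_cong)
    then show ?thesis using int[of i] by (simp add: P_def N_def max_def)
  qed
  let ?E = "\<lambda>F e. {\<omega>\<in>space M. \<exists>j<2 ^ m. \<bar>\<Sum>i\<in>{0<..j}. F i \<omega>\<bar> > e * b m}"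
  have [measurable]: "P i \<in> borel_measurable M" "N i \<in> borel_measurable M" for i
    unfolding P_def N_def by measurable
  have meas: "?E P e \<in> sets M" "?E N e \<in> sets M" for e by measurable
  have "?E (\<lambda>i \<omega>. X i \<omega> - expectation (X i)) \<epsilon> \<subseteq> ?E P (\<epsilon> / 2) \<union> ?E N (\<epsilon> / 2)"
  proof
    fix \<omega> assume "\<omega> \<in> ?E (\<lambda>i \<omega>. X i \<omega> - expectation (X i)) \<epsilon>"
    then have "\<omega> \<in> space M" "\<exists>j<2 ^ m. \<bar>\<Sum>i\<in>{0<..j}. P i \<omega> - N i \<omega>\<bar> > \<epsilon> * b m"
      by (simp_all add: eq)
    then obtain j where \<omega>: "\<omega> \<in> space M" "j < 2 ^ m" "\<bar>sum (\<lambda>i. P i \<omega>) {0<..j} - sum (\<lambda>i. N i \<omega>) {0<..j}\<bar> > \<epsilon> * b m"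
      unfolding sum_subtractf by (elim exE conjE) (rule that)
    have "\<bar>sum (\<lambda>i. P i \<omega>) {0<..j}\<bar> > \<epsilon> / 2 * b m \<or> \<bar>sum (\<lambda>i. N i \<omega>) {0<..j}\<bar> > \<epsilon> / 2 * b m"
      using \<omega>(3) by linarith
    with \<omega>(1,2) show "\<omega> \<in> ?E P (\<epsilon> / 2) \<union> ?E N (\<epsilon> / 2)" by auto
  qed
  then have "prob (?E (\<lambda>i \<omega>. X i \<omega> - expectation (X i)) \<epsilon>) \<le> prob (?E P (\<epsilon> / 2) \<union> ?E N (\<epsilon> / 2))"
    using meas by (intro finite_measure_mono) auto
  also have "\<dots> \<le> prob (?E P (\<epsilon> / 2)) + prob (?E N (\<epsilon> / 2))"
    using meas by (intro measure_Un_le) auto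
  finally have "c m * prob (?E (\<lambda>i \<omega>. X i \<omega> - expectation (X i)) \<epsilon>)
      \<le> c m * (prob (?E P (\<epsilon> / 2)) + prob (?E N (\<epsilon> / 2)))"
    using c by (intro mult_left_mono) auto
  then show "norm (c m * prob {\<omega>\<in>space M. \<exists>j<2 ^ m. \<bar>\<Sum>i\<in>{0<..j}. X i \<omega> - expectation (X i)\<bar> > \<epsilon> * b m})
      \<le> c m * prob {\<omega>\<in>space M. \<exists>j<2 ^ m.
          \<bar>\<Sum>i\<in>{0<..j}. max (X i \<omega>) 0 - expectation (\<lambda>\<omega>. max (X i \<omega>) 0)\<bar> > \<epsilon> / 2 * b m} +
        c m * prob {\<omega>\<in>space M. \<exists>j<2 ^ m.
          \<bar>\<Sum>i\<in>{0<..j}. max (- X i \<omega>) 0 - expectation (\<lambda>\<omega>. max (- X i \<omega>) 0)\<bar> > \<epsilon> / 2 * b m}"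
    using c[of m] by (simp add: P_def N_def distrib_left)
qed (intro summable_add pos neg)

theorem theorem1p1:
  fixes M :: "'a measure" and X :: "nat \<Rightarrow> 'a \<Rightarrow> real" and C p :: real
    and L Lt :: "real \<Rightarrow> real"
  assumes "prob_space M"
    and "\<And>n. X n \<in> borel_measurable M"
    and "\<And>n. integrable M (X n)"
    and "variance_cond M X C"
    and "1 \<le> p" and "p < 2"
    and "slowly_varying L"
    and "de_bruijn_conjugate L Lt"
    and "standing_S L Lt"
    and "p = 1 \<Longrightarrow> (\<forall>x\<ge>0. L x \<ge> 1) \<and> mono_on {0..} L"
    and "(SUP n\<in>{1::nat..}. \<integral>\<^sup>+ \<omega>. ennreal (\<bar>X n \<omega>\<bar> powr p * L \<bar>X n \<omega>\<bar> powr p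
            * logm \<bar>X n \<omega>\<bar> * (logm (logm \<bar>X n \<omega>\<bar>))\<^sup>2) \<partial>M) < \<infinity>"
  shows "\<forall>\<alpha>\<ge>1/p. \<forall>\<epsilon>>0. summable (\<lambda>n::nat.
           real (Suc n) powr (\<alpha> * p - 2) *
           measure M {\<omega>\<in>space M.
              Max ((\<lambda>j. \<bar>\<Sum>i\<in>{1..j}. X i \<omega> - prob_space.expectation M (X i)\<bar>) ` {1..Suc n})
                > \<epsilon> * real (Suc n) powr \<alpha> * Lt (real (Suc n) powr \<alpha>)})"
proof (intro allI impI)
  fix \<alpha> \<epsilon> :: real
  assume \<alpha>: "\<alpha> \<ge> 1 / p" and \<epsilon>: "\<epsilon> > 0"
  interpret prob_space M by fact
  note X_int = assms(3) and p = assms(5,6) and L = assms(7) and conj = assms(8) and S = assms(9)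
  define \<phi> where "\<phi> = (\<lambda>x. x powr p * L x powr p * logm x * (logm (logm x))\<^sup>2)"
  define \<tau> where "\<tau> = \<alpha> * p"
  have \<alpha>0: "\<alpha> > 0" using \<alpha> p by (smt (verit) divide_pos_pos)
  \<comment> \<open>Here \<open>p < 2\<close> opens the gap between \<open>\<tau> / 2\<close> and
    \<open>\<alpha>\<close> in which \<open>q\<close> is chosen below.\<close>
  have \<tau>: "\<tau> \<ge> 1" "\<tau> < 2 * \<alpha>" using \<alpha> \<alpha>0 p by (auto simp: \<tau>_def field_simps)
  obtain x0 where x0: "x0 > 0" and pos: "\<And>x. x \<ge> x0 \<Longrightarrow> \<phi> x > 0"
    and mono: "mono_on {x0..} \<phi>" "mono_on {x0..} (\<lambda>x. \<phi> x / x)" "antimono_on {x0..} (\<lambda>x. \<phi> x / x\<^sup>2)"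
    using weight_monotone[OF standing_S_normalized_slowly_varying[OF L S] p] assms(10) unfolding \<phi>_def by blast
  have \<phi>0: "\<phi> x \<ge> 0" for x
    using logm_ge_1[of x] by (simp add: \<phi>_def)
  define K where "K = enn2real (SUP n\<in>{1::nat..}. \<integral>\<^sup>+ \<omega>. ennreal (\<phi> \<bar>X n \<omega>\<bar>) \<partial>M)"
  \<comment> \<open>The supremum starts at 1, so no weighted moment of \<open>X 0\<close> is
    controlled; the sums over \<open>{0<..j}\<close> avoid that variable.\<close>
  have nn: "(\<integral>\<^sup>+ \<omega>. ennreal (\<phi> \<bar>X n \<omega>\<bar>) \<partial>M) \<le> ennreal K" if "n > 0" for n
  proof -
    have "(SUP n\<in>{1::nat..}. \<integral>\<^sup>+ \<omega>. ennreal (\<phi> \<bar>X n \<omega>\<bar>) \<partial>M) = ennreal K"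
      using assms(11) by (simp add: K_def \<phi>_def)
    moreover have "(\<integral>\<^sup>+ \<omega>. ennreal (\<phi> \<bar>X n \<omega>\<bar>) \<partial>M) \<le> (SUP n\<in>{1::nat..}. \<integral>\<^sup>+ \<omega>. ennreal (\<phi> \<bar>X n \<omega>\<bar>) \<partial>M)"
      using that by (intro SUP_upper) auto
    ultimately show ?thesis by simp
  qed
  have \<phi>_meas: "(\<lambda>\<omega>. \<phi> \<bar>X n \<omega>\<bar>) \<in> borel_measurable M" for n
  proof -
    \<comment> \<open>\<open>L\<close> is continuous only on \<open>{0..}\<close>. Composition with
      \<open>max 0\<close> extends it continuously to the line without changing it at absolute
      values.\<close>
    have "continuous_on UNIV (\<lambda>x. L (max 0 x))"
      using S by (auto simp: standing_S_def intro!: continuous_intros elim!: continuous_on_compose2)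
    then have [measurable]: "(\<lambda>x. L (max 0 x)) \<in> borel_measurable borel"
      by (rule borel_measurable_continuous_onI)
    note [measurable] = assms(2)
    have "(\<lambda>\<omega>. (\<lambda>x. L (max 0 x)) \<bar>X n \<omega>\<bar>) \<in> borel_measurable M" by measurable
    then have [measurable]: "(\<lambda>\<omega>. L \<bar>X n \<omega>\<bar>) \<in> borel_measurable M" by simp
    show ?thesis unfolding \<phi>_def logm_def by measurable
  qed
  have \<phi>_int: "integrable M (\<lambda>\<omega>. \<phi> \<bar>X n \<omega>\<bar>)" if "n > 0" for n
    using nn[OF that] \<phi>0 by (intro integrableI_nonneg \<phi>_meas) (auto intro: order.strict_trans1)
  have \<phi>_K: "expectation (\<lambda>\<omega>. \<phi> \<bar>X n \<omega>\<bar>) \<le> K" if "n > 0" for n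
  proof -
    have "ennreal (expectation (\<lambda>\<omega>. \<phi> \<bar>X n \<omega>\<bar>)) \<le> ennreal K"
      using nn[OF that] nn_integral_eq_integral[OF \<phi>_int[OF that]] \<phi>0 by simp
    then show ?thesis by (simp add: K_def)
  qed
  define w where "w k = 2 powr (real k * \<alpha>) * Lt (2 powr (real k * \<alpha>))" for k :: nat
  \<comment> \<open>The midpoint of the gap: \<open>q < \<alpha>\<close> is allowed by the growth of
    \<open>w\<close>, \<open>q > \<tau> / 2\<close> makes \<open>2 powr (\<tau> - 2 * q)\<close>
    less than 1, and \<open>q > 0\<close> does so for \<open>2 powr (- q)\<close>.\<close>
  define q where "q = (\<tau> / 2 + \<alpha>) / 2"
  have q: "q < \<alpha>" "q > \<tau> / 2" "q > 0" using \<tau> by (auto simp: q_def)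
  have Lt: "slowly_varying Lt" using conj by (simp add: de_bruijn_conjugate_def)
  note y = de_bruijn_conjugate_at_top[OF S conj]
  have x: "filterlim (\<lambda>k::nat. 2 powr (real k * \<alpha>)) at_top sequentially"
    using \<alpha>0 by real_asymp
  have "filterlim w at_top sequentially"
    unfolding w_def by (rule filterlim_compose[OF y x])
  then have "\<forall>\<^sub>F k in sequentially. w k \<ge> x0" unfolding filterlim_at_top by blast
  moreover have "\<forall>\<^sub>F k in sequentially. 2 powr q * w k \<le> w (Suc k)"
    unfolding w_def by (rule de_bruijn_conjugate_dyadic_ratio[OF Lt \<alpha>0 q(1) y])
  ultimately have "\<forall>\<^sub>F k in sequentially. w k \<ge> x0 \<and> 2 powr q * w k \<le> w (Suc k)"
    by (rule eventually_conj)
  then obtain k0 where k0: "\<And>k. k \<ge> k0 \<Longrightarrow> w k \<ge> x0 \<and> 2 powr q * w k \<le> w (Suc k)"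
    unfolding eventually_sequentially by blast
  \<comment> \<open>Chaining uses every level from \<open>0\<close> on; the shift only costs a constant factor in the threshold.\<close>
  define b where "b k = w (k + k0)" for k
  have b: "b k \<ge> x0" "2 powr q * b k \<le> b (Suc k)" "b k > 0" for k
    using k0[of "k + k0"] x0 by (auto simp: b_def)
  have s: "2 powr (- q) < (1::real)" "b k \<le> 2 powr (- q) * b (Suc k)" for k
    using powr_less_mono[of "- q" 0 2] q b(2)[of k] by (auto simp: powr_minus field_simps)
  have r: "2 powr (\<tau> - 2 * q) < (1::real)" "2 powr \<tau> * (b k)\<^sup>2 \<le> 2 powr (\<tau> - 2 * q) * (b (Suc k))\<^sup>2" for k
  proof -
    show "2 powr (\<tau> - 2 * q) < (1::real)" using powr_less_mono[of "\<tau> - 2 * q" 0 2] q by simp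
    have "(2 powr q * b k)\<^sup>2 \<le> (b (Suc k))\<^sup>2" using b(2)[of k] b(3)[of k] by (intro power_mono) auto
    then have "2 powr (\<tau> - 2 * q) * (2 powr q * b k)\<^sup>2 \<le> 2 powr (\<tau> - 2 * q) * (b (Suc k))\<^sup>2"
      by (intro mult_left_mono) auto
    moreover have "2 powr (\<tau> - 2 * q) * (2 powr q)\<^sup>2 = 2 powr \<tau>"
      by (simp add: power2_eq_square flip: powr_add)
    ultimately show "2 powr \<tau> * (b k)\<^sup>2 \<le> 2 powr (\<tau> - 2 * q) * (b (Suc k))\<^sup>2"
      by (simp only: power_mult_distrib mult.assoc[symmetric])
  qed
  have "summable (\<lambda>k. 2 powr (real k * \<tau>) / \<phi> (w k))"
    using summable_weight_at_conjugate[OF L S conj, of p \<alpha>] p \<alpha>0 by (simp add: \<phi>_def w_def \<tau>_def)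
  then have "summable (\<lambda>k. 2 powr (real (k + k0) * \<tau>) / \<phi> (w (k + k0)))"
    by (rule summable_ignore_initial_segment)
  then have sum: "summable (\<lambda>k. 2 powr (real k * \<tau>) / \<phi> (b k))"
  proof (rule summable_comparison_test'[where N = 0])
    fix k :: nat
    have "2 powr (real k * \<tau>) \<le> 2 powr (real (k + k0) * \<tau>)"
      using \<tau> by (intro powr_mono mult_right_mono) auto
    then show "norm (2 powr (real k * \<tau>) / \<phi> (b k)) \<le> 2 powr (real (k + k0) * \<tau>) / \<phi> (w (k + k0))"
      using pos[OF b(1)[of k]] by (simp add: b_def divide_right_mono)
  qed
  have vc: "variance_cond M X (max C 0)" by (rule variance_cond_mono[OF assms(4)]) simp
  have mono_max: "mono (\<lambda>x::real. max x 0)" by (auto simp: mono_def)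
  have dev: "summable (\<lambda>m. 2 powr (real m * (\<tau> - 1)) *
      prob {\<omega>\<in>space M. \<exists>j<2 ^ m. \<bar>\<Sum>i\<in>{0<..j}. Y i \<omega> - expectation (Y i)\<bar> > e * b m})"
    if "variance_cond M Y (max C 0)" "\<And>n. integrable M (Y n)" "\<And>n \<omega>. 0 \<le> Y n \<omega>"
      "\<And>n \<omega>. Y n \<omega> \<le> \<bar>X n \<omega>\<bar>" "e > 0" for Y e
    by (rule weighted_deviation_summable[OF that(1) max.cobounded2 that(2,3,4) \<phi>_int \<phi>_K \<phi>0 x0 pos
          mono b(1) sum \<tau>(1) r s that(5)])
  have Q: "summable (\<lambda>m. 2 powr (real m * (\<tau> - 1)) *
      prob {\<omega>\<in>space M. \<exists>j<2 ^ m. \<bar>\<Sum>i\<in>{0<..j}. X i \<omega> - expectation (X i)\<bar> > e * b m})" if "e > 0" for e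
  proof (rule deviation_summable_signed[OF X_int])
    show "summable (\<lambda>m. 2 powr (real m * (\<tau> - 1)) * prob {\<omega>\<in>space M. \<exists>j<2 ^ m.
        \<bar>\<Sum>i\<in>{0<..j}. max (X i \<omega>) 0 - expectation (\<lambda>\<omega>. max (X i \<omega>) 0)\<bar> > e / 2 * b m})"
      by (rule dev[OF variance_cond_mono_comp[OF vc mono_max]]) (use X_int that in auto)
    show "summable (\<lambda>m. 2 powr (real m * (\<tau> - 1)) * prob {\<omega>\<in>space M. \<exists>j<2 ^ m.
        \<bar>\<Sum>i\<in>{0<..j}. max (- X i \<omega>) 0 - expectation (\<lambda>\<omega>. max (- X i \<omega>) 0)\<bar> > e / 2 * b m})"
      by (rule dev[OF variance_cond_mono_comp[OF variance_cond_uminus[OF vc] mono_max]]) (use X_int that in auto)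
  qed simp
  \<comment> \<open>For \<open>floor_log n = m\<close> the constant \<open>b (Suc m)\<close> belongs
    to the argument \<open>2 powr (real (Suc m + k0) * \<alpha>)\<close>, which is at most
    \<open>lam * real n powr \<alpha>\<close>. Replacing the threshold at \<open>n\<close> by the
    one at \<open>Suc m\<close> therefore costs only the factor \<open>c\<close>.\<close>
  define lam where "lam = 2 powr (\<alpha> * (1 + real k0))"
  have "lam \<ge> 1" unfolding lam_def using \<alpha>0 by (intro ge_one_powr_ge_zero) auto
  then obtain c where c: "c > 0"
    and comp: "\<forall>\<^sub>F x in at_top. \<forall>z. x \<le> z \<and> z \<le> lam * x \<longrightarrow> c * (z * Lt z) \<le> x * Lt x"
    using de_bruijn_comparable[OF L S conj] by blast
  define E where "E m = {\<omega>\<in>space M. \<exists>j<2 ^ m. \<bar>\<Sum>i\<in>{0<..j}. X i \<omega> - expectation (X i)\<bar> > \<epsilon> * c * b m}" for m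
  define A where "A n = {\<omega>\<in>space M. Max ((\<lambda>j. \<bar>\<Sum>i\<in>{1..j}. X i \<omega> - expectation (X i)\<bar>) ` {1..n})
      > \<epsilon> * real n powr \<alpha> * Lt (real n powr \<alpha>)}" for n
  \<comment> \<open>The index is \<open>Suc m\<close> because \<open>floor_log n = m\<close> gives
    \<open>n < 2 ^ Suc m\<close>, and \<open>E\<close> uses the strict bound on
    \<open>j\<close>.\<close>
  define h where "h m = 2 powr \<bar>\<tau> - 2\<bar> * 2 powr (real m * (\<tau> - 2)) * prob (E (Suc m))" for m :: nat
  have E_meas: "E m \<in> sets M" for m unfolding E_def using assms(2) by measurable
  have n_top: "filterlim (\<lambda>n::nat. real n powr \<alpha>) at_top sequentially" using \<alpha>0 by real_asymp
  have "\<forall>\<^sub>F n in sequentially. \<forall>z. real n powr \<alpha> \<le> z \<and> z \<le> lam * real n powr \<alpha>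
      \<longrightarrow> c * (z * Lt z) \<le> real n powr \<alpha> * Lt (real n powr \<alpha>)"
    by (rule eventually_compose_filterlim[OF comp n_top])
  then have bound: "\<forall>\<^sub>F n in sequentially. 0 \<le> real n powr (\<tau> - 2) * prob (A n) \<and>
      real n powr (\<tau> - 2) * prob (A n) \<le> h (floor_log n)"
    using eventually_gt_at_top[of 0]
  proof eventually_elim
    case (elim n)
    define m where "m = floor_log n"
    define z where "z = 2 powr (real (Suc m + k0) * \<alpha>)"
    have "2 ^ m \<le> n" unfolding m_def using elim by (intro floor_log_exp2_le) auto
    then have "real (2 ^ m) \<le> real n" by (simp only: of_nat_le_iff)
    then have n_ge: "2 powr real m \<le> real n" by (simp add: powr_realpow)
    have n_less: "n < 2 ^ Suc m" using floor_log_exp2_gt[of n] by (simp add: m_def)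
    then have "real n < real (2 ^ Suc m)" by (simp only: of_nat_less_iff)
    also have "\<dots> = 2 powr real (Suc m)" by (subst powr_realpow) auto
    also have "\<dots> \<le> 2 powr real (Suc m + k0)" by (intro powr_mono) auto
    finally have "real n powr \<alpha> \<le> (2 powr real (Suc m + k0)) powr \<alpha>"
      using \<alpha>0 by (intro powr_mono2) auto
    then have "real n powr \<alpha> \<le> z" by (simp only: z_def powr_powr)
    moreover have "z = lam * (2 powr real m) powr \<alpha>"
      by (simp add: z_def lam_def powr_powr algebra_simps flip: powr_add)
    then have "z \<le> lam * real n powr \<alpha>"
      using n_ge \<alpha>0 \<open>lam \<ge> 1\<close> by (auto intro!: mult_left_mono powr_mono2)
    ultimately have "c * (z * Lt z) \<le> real n powr \<alpha> * Lt (real n powr \<alpha>)" using elim by blast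
    moreover have "z * Lt z = b (Suc m)" by (simp add: z_def b_def w_def)
    ultimately have "\<epsilon> * (c * b (Suc m)) \<le> \<epsilon> * (real n powr \<alpha> * Lt (real n powr \<alpha>))"
      using \<epsilon> by (intro mult_left_mono) auto
    then have level: "\<epsilon> * c * b (Suc m) \<le> \<epsilon> * real n powr \<alpha> * Lt (real n powr \<alpha>)" by (simp only: mult.assoc)
    have "A n \<subseteq> E (Suc m)"
    proof
      fix \<omega> assume \<omega>: "\<omega> \<in> A n"
      let ?f = "\<lambda>j. \<bar>\<Sum>i\<in>{1..j}. X i \<omega> - expectation (X i)\<bar>"
      have "Max (?f ` {1..n}) \<in> ?f ` {1..n}" using elim by (intro Max_in) auto
      then obtain j where j: "j \<in> {1..n}" "Max (?f ` {1..n}) = ?f j" by (elim imageE) (rule that)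
      have "Max (?f ` {1..n}) > \<epsilon> * real n powr \<alpha> * Lt (real n powr \<alpha>)"
        using \<omega> by (simp add: A_def)
      then have "?f j > \<epsilon> * c * b (Suc m)" using level j(2) by linarith
      moreover have "{1..j} = {0<..j}" by auto
      moreover have "j < 2 ^ Suc m" using j(1) n_less by simp
      ultimately show "\<omega> \<in> E (Suc m)" using \<omega> unfolding A_def E_def by auto
    qed
    then have "prob (A n) \<le> prob (E (Suc m))" using E_meas by (intro finite_measure_mono) auto
    then have "real n powr (\<tau> - 2) * prob (A n) \<le>
        2 powr \<bar>\<tau> - 2\<bar> * 2 powr (real m * (\<tau> - 2)) * prob (E (Suc m))"
      unfolding m_def using elim by (intro mult_mono powr_dyadic_le) auto
    then show ?case by (simp add: h_def m_def)
  qed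
  have "summable (\<lambda>m. 2 powr (real (Suc m) * (\<tau> - 1)) * prob (E (Suc m)))"
    using Q[of "\<epsilon> * c"] \<epsilon> c unfolding E_def by (subst summable_Suc_iff) auto
  \<comment> \<open>The factor \<open>2 powr (1 - \<tau>)\<close> undoes the shift to
    \<open>Suc m\<close>; what is left, \<open>2 powr (m * (\<tau> - 1))\<close>, is
    \<open>2 ^ m * 2 powr (m * (\<tau> - 2))\<close>.\<close>
  then have "summable (\<lambda>m. 2 powr \<bar>\<tau> - 2\<bar> * 2 powr (1 - \<tau>) * (2 powr (real (Suc m) * (\<tau> - 1)) * prob (E (Suc m))))"
    by (rule summable_mult)
  moreover have "2 powr \<bar>\<tau> - 2\<bar> * 2 powr (1 - \<tau>) * (2 powr (real (Suc m) * (\<tau> - 1)) * prob (E (Suc m))) = 2 ^ m * h m" for m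
  proof -
    have "2 powr (1 - \<tau>) * 2 powr (real (Suc m) * (\<tau> - 1)) = 2 powr real m * 2 powr (real m * (\<tau> - 2))"
      by (simp add: algebra_simps flip: powr_add)
    then show ?thesis by (simp add: h_def powr_realpow mult_ac)
  qed
  ultimately have "summable (\<lambda>m. 2 ^ m * h m)" by (simp only:)
  then have "summable (\<lambda>n. real (Suc n) powr (\<tau> - 2) * prob (A (Suc n)))"
    by (intro summable_of_dyadic_blocks[OF bound]) (auto simp: h_def)
  then show "summable (\<lambda>n::nat.
           real (Suc n) powr (\<alpha> * p - 2) *
           measure M {\<omega>\<in>space M.
              Max ((\<lambda>j. \<bar>\<Sum>i\<in>{1..j}. X i \<omega> - prob_space.expectation M (X i)\<bar>) ` {1..Suc n})
                > \<epsilon> * real (Suc n) powr \<alpha> * Lt (real (Suc n) powr \<alpha>)})"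
    by (simp only: A_def \<tau>_def)
qed

end
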